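(* In the setting described in the context (with $f_i,g_i,h_i,\lambda_i,\mu_i$ satisfying all standing assumptions there), suppose that $m_1\ge n$ and $$\int_1^\infty\left(\zeta^{\lambda_1\lambda_2}g_1(\zeta)g_2^{\lambda_1}(\zeta)\right)^{-1/(m_1+\lambda_1m_2)}\zeta^{1/(m_1+\lambda_1m_2)-1}\,d\zeta<\infty.$$ Then all solutions $(u_1,u_2)$ of the system $$\sum_{|\alpha|=m_1}\partial^\alpha a_\alpha(x,u_1)\ge f_1(|u_2|),\qquad \sum_{|\alpha|=m_2}\partial^\alpha b_\alpha(x,u_2)\ge f_2(|u_1|)\quad\text{in }\mathbb R^n$$ are trivial, i.e. $u_1=u_2=0$ almost everywhere in $\mathbb R^n$.
   Context: Setting and standing assumptions. Let $n,m_1,m_2\ge1$ be integers. For multi-indices $\alpha$ with $|\alpha|=m_1$ and $\beta$ with $|\beta|=m_2$ let $a_\alpha,b_\beta:\mathbb R^n\times\mathbb R\to\mathbb R$ be Carathéodory functions such that, with some constant $A>0$, $|a_\alpha(x,\zeta)|+|b_\beta(x,\zeta)|\le A|\zeta|$ for almost all $x\in\mathbb R^n$ and all $\zeta\in\mathbb R$. Let $f_1,f_2:[0,\infty)\to[0,\infty)$ be non-decreasing and convex. Assume there are real numbers $\lambda_i,\mu_i\in[1,\infty)$ and non-decreasing continuous functions $g_i:[1,\infty)\to(0,\infty)$ and $h_i:(0,1]\to(0,\infty)$, $i=1,2$, such that $f_i(\zeta)\ge\zeta^{\lambda_i}g_i(\zeta)$ for all $\zeta\in[1,\infty)$, $f_i(\zeta)\ge\zeta^{\mu_i}h_i(\zeta)$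 for all $\zeta\in(0,1]$, and, for all $\varkappa\in(0,1)$, $$\liminf_{\zeta\to\infty}\frac{g_i(\zeta^\varkappa)}{g_i(\zeta)}>0,\qquad \liminf_{\zeta\to+0}\frac{h_i(\zeta)}{h_i(\zeta^\varkappa)}>0 .$$ Solutions. Functions $u_1,u_2\in L_{1,loc}(\mathbb R^n)$ are called solutions of the system if $f_1(|u_2|),f_2(|u_1|)\in L_{1,loc}(\mathbb R^n)$ and, for every non-negative $\varphi\in C_0^\infty(\mathbb R^n)$, $$(-1)^{m_1}\int_{\mathbb R^n}\sum_{|\alpha|=m_1}a_\alpha(x,u_1)\,\partial^\alpha\varphi\,dx\ge\int_{\mathbb R^n}f_1(|u_2|)\varphi\,dx,\qquad (-1)^{m_2}\int_{\mathbb R^n}\sum_{|\alpha|=m_2}b_\alpha(x,u_2)\,\partial^\alpha\varphi\,dx\ge\int_{\mathbb R^n}f_2(|u_1|)\varphi\,dx .$$ *)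

theory Defs
  imports "HOL-Analysis.Analysis"
begin

text \<open>Multi-indices over the coordinates of \<open>real ^ 'n\<close> are functions \<open>'n \<Rightarrow> nat\<close>.\<close>

definition multi_indices :: "nat \<Rightarrow> ('n::finite \<Rightarrow> nat) set" where
  "multi_indices m = {\<alpha>. (\<Sum>i\<in>UNIV. \<alpha> i) = m}"

definition partial_deriv :: "'n::finite \<Rightarrow> (real ^ 'n \<Rightarrow> real) \<Rightarrow> real ^ 'n \<Rightarrow> real" where
  "partial_deriv i \<phi> x = deriv (\<lambda>t. \<phi> (x + t *\<^sub>R axis i 1)) 0"

primrec iterated_partial :: "'n::finite list \<Rightarrow> (real ^ 'n \<Rightarrow> real) \<Rightarrow> real ^ 'n \<Rightarrow> real" where
  "iterated_partial [] \<phi> = \<phi>"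
| "iterated_partial (i # js) \<phi> = partial_deriv i (iterated_partial js \<phi>)"

text \<open>
  The index type carries no order, so an order of differentiation is chosen arbitrarily. For smooth
  functions (the only ones it is applied to) the choice is irrelevant by Schwarz's theorem.
\<close>

definition multi_partial :: "('n::finite \<Rightarrow> nat) \<Rightarrow> (real ^ 'n \<Rightarrow> real) \<Rightarrow> real ^ 'n \<Rightarrow> real" where
  "multi_partial \<alpha> \<phi> = iterated_partial (SOME js. \<forall>i. count_list js i = \<alpha> i) \<phi>"

lemma ex_list_of_multi_index: "\<exists>js. \<forall>i. count_list js i = \<alpha> i"
  for \<alpha> :: "'n::finite \<Rightarrow> nat"
proof -
  have "\<exists>js. \<forall>i. count_list js i = (if i \<in> S then \<alpha> i else 0)" if "finite S" for S :: "'n set"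
    using that
  proof induction
    case empty
    show ?case by (rule exI[of _ "[]"]) simp
  next
    case (insert s S)
    then obtain js where js: "\<And>i. count_list js i = (if i \<in> S then \<alpha> i else 0)"
      by blast
    have rep: "count_list (replicate k s) i = (if i = s then k else 0)" for k i
      by (induction k) auto
    show ?case
      by (rule exI[of _ "replicate (\<alpha> s) s @ js"]) (use insert in \<open>auto simp: js rep\<close>)
  qed
  from this[of UNIV] show ?thesis by simp
qed

text \<open>All partial derivatives of all orders exist everywhere and are continuous.\<close>

definition smooth :: "(real ^ 'n::finite \<Rightarrow> real) \<Rightarrow> bool" where
  "smooth \<phi> \<longleftrightarrow> (\<forall>js.
     continuous_on UNIV (iterated_partial js \<phi>) \<and>
     (\<forall>i x. (\<lambda>t. iterated_partial js \<phi> (x + t *\<^sub>R axis i 1)) differentiable (at 0)))"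

definition test_function :: "(real ^ 'n::finite \<Rightarrow> real) \<Rightarrow> bool" where
  "test_function \<phi> \<longleftrightarrow> smooth \<phi> \<and> compact (closure {x. \<phi> x \<noteq> 0})"

definition locally_integrable :: "(real ^ 'n::finite \<Rightarrow> real) \<Rightarrow> bool" where
  "locally_integrable u \<longleftrightarrow> (\<forall>K. compact K \<longrightarrow> set_integrable lebesgue K u)"

definition caratheodory :: "(real ^ 'n::finite \<Rightarrow> real \<Rightarrow> real) \<Rightarrow> bool" where
  "caratheodory a \<longleftrightarrow>
     (\<forall>\<zeta>. (\<lambda>x. a x \<zeta>) \<in> borel_measurable lebesgue) \<and>
     (AE x in lebesgue. continuous_on UNIV (a x))"

text \<open>
  The hypotheses on one of the nonlinearities \<open>f\<^sub>i\<close>. The functions \<open>f\<close>, \<open>g\<close>, \<open>h\<close> live on \<open>[0,\<infinity>)\<close>,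
  \<open>[1,\<infinity>)\<close>, \<open>(0,1]\<close>; their values elsewhere are unconstrained.
\<close>

definition admissible_nonlinearity ::
  "(real \<Rightarrow> real) \<Rightarrow> real \<Rightarrow> real \<Rightarrow> (real \<Rightarrow> real) \<Rightarrow> (real \<Rightarrow> real) \<Rightarrow> bool" where
  "admissible_nonlinearity f lam mu g h \<longleftrightarrow>
     (\<forall>\<zeta>\<ge>0. f \<zeta> \<ge> 0) \<and> mono_on {0..} f \<and> convex_on {0..} f \<and>
     lam \<ge> 1 \<and> mu \<ge> 1 \<and>
     (\<forall>\<zeta>\<ge>1. g \<zeta> > 0) \<and> mono_on {1..} g \<and> continuous_on {1..} g \<and>
     (\<forall>\<zeta>\<in>{0<..1}. h \<zeta> > 0) \<and> mono_on {0<..1} h \<and> continuous_on {0<..1} h \<and>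
     (\<forall>\<zeta>\<ge>1. f \<zeta> \<ge> \<zeta> powr lam * g \<zeta>) \<and>
     (\<forall>\<zeta>\<in>{0<..1}. f \<zeta> \<ge> \<zeta> powr mu * h \<zeta>) \<and>
     (\<forall>\<kappa>\<in>{0<..<1}. Liminf at_top (\<lambda>\<zeta>. ereal (g (\<zeta> powr \<kappa>) / g \<zeta>)) > 0) \<and>
     (\<forall>\<kappa>\<in>{0<..<1}. Liminf (at_right 0) (\<lambda>\<zeta>. ereal (h \<zeta> / h (\<zeta> powr \<kappa>))) > 0)"

text \<open>
  For Caratheodory functions with the growth bound
  \<open>\<bar>a \<alpha> x \<zeta>\<bar> + \<bar>b \<beta> x \<zeta>\<bar> \<le> A * \<bar>\<zeta>\<bar>\<close> all integrands below
  are Lebesgue integrable, so the Bochner integrals are not default values.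
\<close>

definition weak_solution ::
  "nat \<Rightarrow> nat \<Rightarrow> (('n::finite \<Rightarrow> nat) \<Rightarrow> real ^ 'n \<Rightarrow> real \<Rightarrow> real) \<Rightarrow>
   (('n \<Rightarrow> nat) \<Rightarrow> real ^ 'n \<Rightarrow> real \<Rightarrow> real) \<Rightarrow> (real \<Rightarrow> real) \<Rightarrow> (real \<Rightarrow> real) \<Rightarrow>
   (real ^ 'n \<Rightarrow> real) \<Rightarrow> (real ^ 'n \<Rightarrow> real) \<Rightarrow> bool" where
  "weak_solution m1 m2 a b f1 f2 u1 u2 \<longleftrightarrow>
     locally_integrable u1 \<and> locally_integrable u2 \<and>
     locally_integrable (\<lambda>x. f1 \<bar>u2 x\<bar>) \<and> locally_integrable (\<lambda>x. f2 \<bar>u1 x\<bar>) \<and>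
     (\<forall>\<phi>. test_function \<phi> \<and> (\<forall>x. \<phi> x \<ge> 0) \<longrightarrow>
        (-1) ^ m1 * (\<integral>x. (\<Sum>\<alpha>\<in>multi_indices m1. a \<alpha> x (u1 x) * multi_partial \<alpha> \<phi> x) \<partial>lebesgue)
          \<ge> (\<integral>x. f1 \<bar>u2 x\<bar> * \<phi> x \<partial>lebesgue) \<and>
        (-1) ^ m2 * (\<integral>x. (\<Sum>\<beta>\<in>multi_indices m2. b \<beta> x (u2 x) * multi_partial \<beta> \<phi> x) \<partial>lebesgue)
          \<ge> (\<integral>x. f2 \<bar>u1 x\<bar> * \<phi> x \<partial>lebesgue))"

end

theory Submission
  imports Defs
begin

text \<open>
  The argument is by blow-up of averages over cubes. Testing the two inequalities with a cut-off that
  is 1 on the cube of half-side \<open>r\<close> and vanishes outside that of half-side \<open>R\<close>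
  (\<open>cube_cutoff\<close>) bounds \<open>(R - r) ^ m1\<close> times the integral of \<open>f1 \<bar>u2\<bar>\<close> over the
  small cube by a multiple of the integral of \<open>\<bar>u1\<bar>\<close> over the large one, and likewise for the
  second inequality (\<open>cube_integral_estimate\<close>). Let \<open>P r\<close> and \<open>Q r\<close> be the means of
  \<open>\<bar>u1\<bar>\<close> and \<open>\<bar>u2\<bar>\<close> over the cube of half-side \<open>r\<close>. By Jensen's
  inequality, for \<open>r < R \<le> 2 * r\<close>,
  \<open>(R - r) ^ m1 * f1 (Q r) \<le> C * P R\<close> and \<open>(R - r) ^ m2 * f2 (P r) \<le> C * Q R\<close>.

  Suppose that \<open>f1 \<bar>u2\<bar>\<close> has a positive integral over some cube. Since \<open>m1\<close> is at least
  the dimension, the first estimate keeps \<open>P\<close> away from 0 at infinity, and then both inequalities force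
  \<open>P\<close> to grow at least linearly (\<open>linear_growth\<close>). Once \<open>P r\<close> is at least a large
  \<open>\<omega>\<close>, it reaches \<open>2 * \<omega>\<close> after an increase of the radius by at most a multiple of
  \<open>(\<omega> powr (lam1 * lam2) * g1 \<omega> * g2 \<omega> powr lam1) powr (- 1 / s) * \<omega> powr (1 / s)\<close> plus
  a negative power of \<open>\<omega>\<close>, where \<open>s = m1 + lam1 * m2\<close> (\<open>doubling_step\<close>). The integral
  condition makes these increments summable over a dyadic sequence of values \<open>\<omega>\<close>
  (\<open>summable_dyadic_if_nn_integral_finite\<close>), so \<open>P\<close> would become infinite at a finite radius
  (\<open>averages_blow_up\<close>), although \<open>u1\<close> is locally integrable.

  Hence \<open>f1 \<bar>u2\<bar> = 0\<close> almost everywhere. As \<open>f1\<close> and \<open>f2\<close> are positive on the positive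
  axis, this gives \<open>u2 = 0\<close>, and then the second estimate gives \<open>u1 = 0\<close>.
\<close>

section \<open>Smooth functions of one variable\<close>

text \<open>
  A smooth function of one variable together with all its derivatives: \<open>F k\<close> is the
  \<open>k\<close>-th derivative of \<open>F 0\<close>.
\<close>

definition derivative_sequence :: "(nat \<Rightarrow> real \<Rightarrow> real) \<Rightarrow> bool" where
  "derivative_sequence F \<longleftrightarrow> (\<forall>k t. (F k has_real_derivative F (Suc k) t) (at t))"

lemma derivative_sequenceD:
  "derivative_sequence F \<Longrightarrow> (F k has_real_derivative F (Suc k) t) (at t)"
  by (simp add: derivative_sequence_def)

lemma derivative_sequence_affine:
  assumes "derivative_sequence F"
  shows "derivative_sequence (\<lambda>k t. c ^ k * F k (c * t + e))"
  unfolding derivative_sequence_def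
proof (intro allI)
  fix k t
  have "((\<lambda>t. F k (c * t + e)) has_real_derivative F (Suc k) (c * t + e) * c) (at t)"
    by (rule DERIV_chain2[OF derivative_sequenceD[OF assms]]) (auto intro!: derivative_eq_intros)
  from DERIV_cmult[OF this, of "c ^ k"]
  show "((\<lambda>t. c ^ k * F k (c * t + e)) has_real_derivative c ^ Suc k * F (Suc k) (c * t + e)) (at t)"
    by (simp add: mult_ac)
qed

lemma derivative_sequence_mult:
  assumes "derivative_sequence F" "derivative_sequence G"
  obtains H where "derivative_sequence H" "H 0 = (\<lambda>t. F 0 t * G 0 t)"
proof -
  \<comment> \<open>The pairs in \<open>L k\<close> list the terms of the Leibniz rule, with repetitions in place of binomial coefficients.\<close>
  define L :: "nat \<Rightarrow> (nat \<times> nat) list" where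
    "L = rec_nat [(0, 0)] (\<lambda>_ l. concat (map (\<lambda>(i, j). [(Suc i, j), (i, Suc j)]) l))"
  define S where "S = (\<lambda>l t. (\<Sum>(i, j)\<leftarrow>l. F i t * G j t))"
  have "((S l) has_real_derivative S (concat (map (\<lambda>(i, j). [(Suc i, j), (i, Suc j)]) l)) t) (at t)"
    for l t
  proof (induction l)
    case Nil
    then show ?case by (simp add: S_def)
  next
    case (Cons x l)
    obtain i j where x: "x = (i, j)" by fastforce
    have "((\<lambda>t. F i t * G j t + S l t) has_real_derivative
        F (Suc i) t * G j t + G (Suc j) t * F i t + S (concat (map (\<lambda>(i, j). [(Suc i, j), (i, Suc j)]) l)) t) (at t)"
      by (intro DERIV_add DERIV_mult derivative_sequenceD assms Cons)
    then show ?case by (simp add: S_def x algebra_simps)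
  qed
  then have "derivative_sequence (\<lambda>k. S (L k))"
    by (simp add: derivative_sequence_def L_def)
  moreover have "S (L 0) = (\<lambda>t. F 0 t * G 0 t)"
    by (simp add: S_def L_def)
  ultimately show thesis by (rule that)
qed

lemma poly_times_exp_minus_tendsto_0:
  fixes p :: "real poly"
  shows "((\<lambda>x. poly p x * exp (- x)) \<longlongrightarrow> 0) at_top"
proof -
  have "((\<lambda>x. \<Sum>i\<le>degree p. coeff p i * (x ^ i / exp x)) \<longlongrightarrow> (\<Sum>i\<le>degree p. coeff p i * 0)) at_top"
    by (intro tendsto_sum tendsto_mult tendsto_const tendsto_power_div_exp_0)
  then show ?thesis
    by (simp add: poly_altdef exp_minus sum_distrib_right divide_inverse mult.assoc)
qed

text \<open>
  The \<open>k\<close>-th derivative of \<open>exp (- 1 / t)\<close> on the positive axis is a polynomial in \<open>1 / t\<close>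
  times \<open>exp (- 1 / t)\<close>, so it vanishes to every order at the origin.
\<close>

lemma flat_exponential:
  obtains F where "derivative_sequence F" "F 0 = (\<lambda>t. if t > 0 then exp (- 1 / t) else 0)"
proof -
  define P :: "nat \<Rightarrow> real poly" where "P = rec_nat 1 (\<lambda>_ p. monom 1 2 * (p - pderiv p))"
  define F where "F = (\<lambda>k (t::real). if t > 0 then poly (P k) (1 / t) * exp (- 1 / t) else 0)"
  have PS: "P (Suc k) = monom 1 2 * (P k - pderiv (P k))" for k by (simp add: P_def)
  have "(F k has_real_derivative F (Suc k) t) (at t)" for k t
  proof -
    consider "t > 0" | "t < 0" | "t = 0" by linarith
    then show ?thesis
    proof cases
      case 1
      have "((\<lambda>t. poly (P k) (1 / t) * exp (- 1 / t)) has_real_derivative F (Suc k) t) (at t)"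
        using 1 by (auto intro!: derivative_eq_intros DERIV_chain2[OF poly_DERIV]
            simp: F_def PS poly_monom divide_simps power2_eq_square) (simp add: algebra_simps)
      then show ?thesis
        by (rule has_field_derivative_transform_within_open[of _ _ _ "{0<..}"]) (use 1 in \<open>auto simp: F_def\<close>)
    next
      case 2
      have "((\<lambda>_. 0) has_real_derivative F (Suc k) t) (at t)"
        using 2 by (simp add: F_def)
      then show ?thesis
        by (rule has_field_derivative_transform_within_open[of _ _ _ "{..<0}"]) (use 2 in \<open>auto simp: F_def\<close>)
    next
      case 3
      have "((\<lambda>y. poly (monom 1 1 * P k) y * exp (- y)) \<longlongrightarrow> 0) at_top"
        by (rule poly_times_exp_minus_tendsto_0)
      from filterlim_compose[OF this filterlim_inverse_at_top_right]
      have "((\<lambda>h. poly (monom 1 1 * P k) (inverse h) * exp (- inverse h)) \<longlongrightarrow> 0) (at_right 0)" .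
      moreover have "\<forall>\<^sub>F h in at_right 0. poly (monom 1 1 * P k) (inverse h) * exp (- inverse h) = F k h / h"
        by (rule eventually_at_right_less[THEN eventually_mono])
          (simp add: F_def poly_monom field_simps)
      ultimately have "((\<lambda>h. F k h / h) \<longlongrightarrow> 0) (at_right 0)"
        using tendsto_cong by force
      moreover have "((\<lambda>h. F k h / h) \<longlongrightarrow> 0) (at_left 0)"
        by (rule tendsto_eventually) (auto simp: eventually_at_left_field F_def intro: exI[of _ "-1"])
      ultimately have "((\<lambda>h. F k h / h) \<longlongrightarrow> 0) (at 0)"
        using filterlim_split_at by blast
      then show ?thesis
        unfolding DERIV_def using 3 by (simp only: add_0_left) (simp add: F_def)
    qed
  qed
  then have "derivative_sequence F" by (simp add: derivative_sequence_def)
  moreover have "F 0 = (\<lambda>t. if t > 0 then exp (- 1 / t) else 0)"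
    by (auto simp: F_def P_def)
  ultimately show thesis by (rule that)
qed

text \<open>
  The step is the normalised primitive of the bump \<open>exp (- 1 / t) * exp (- 1 / (1 - t))\<close> on
  the unit interval.
\<close>

lemma smooth_step:
  obtains \<theta> where "derivative_sequence \<theta>"
    "\<And>t. t \<le> 0 \<Longrightarrow> \<theta> 0 t = 0" "\<And>t. t \<ge> 1 \<Longrightarrow> \<theta> 0 t = 1"
    "\<And>t. 0 \<le> \<theta> 0 t \<and> \<theta> 0 t \<le> 1"
    "\<And>k. \<exists>M. \<forall>t. \<bar>\<theta> k t\<bar> \<le> M"
proof -
  obtain F where F: "derivative_sequence F" "F 0 = (\<lambda>t. if t > 0 then exp (- 1 / t) else 0)"
    by (rule flat_exponential)
  have "derivative_sequence (\<lambda>k t. (-1) ^ k * F k ((-1) * t + 1))"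
    by (rule derivative_sequence_affine[OF F(1)])
  from derivative_sequence_mult[OF F(1) this]
  obtain B where B: "derivative_sequence B" "B 0 = (\<lambda>t. F 0 t * F 0 (1 - t))"
    by (auto simp: add_ac)
  have B_pos: "B 0 t > 0" if "0 < t" "t < 1" for t
    using that by (simp add: B F)
  have B_nn: "B 0 t \<ge> 0" for t
    by (simp add: B F)
  have B_out: "B 0 t = 0" if "t \<notin> {0<..<1}" for t
    using that by (auto simp: B F)
  have B_cont: "continuous_on S (B k)" for S k
    by (intro continuous_at_imp_continuous_on ballI DERIV_isCont[OF derivative_sequenceD[OF B(1)]])
  \<comment> \<open>The lower limit -1 instead of 0 makes 0 an interior point of the domain of integration.\<close>
  define I where "I = (\<lambda>t. integral {-1..t} (B 0))"
  have I_int: "B 0 integrable_on {a..b}" for a b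
    by (intro integrable_continuous_interval B_cont)
  have I_0: "I t = 0" if "t \<le> 0" for t
  proof -
    have "I t = integral {-1..t} (\<lambda>_. 0)"
      unfolding I_def using that by (intro integral_cong B_out) auto
    then show ?thesis by simp
  qed
  have I_add: "I t = I s + integral {s..t} (B 0)" if "-1 \<le> s" "s \<le> t" for s t
    unfolding I_def using that by (intro Henstock_Kurzweil_Integration.integral_combine[symmetric] I_int) auto
  have I_1: "I t = I 1" if "t \<ge> 1" for t
  proof -
    have "integral {1..t} (B 0) = integral {1..t} (\<lambda>_. 0)"
      by (intro integral_cong B_out) auto
    with I_add[of 1 t] that show ?thesis by simp
  qed
  have I_mono: "I s \<le> I t" if "s \<le> t" for s t
  proof (cases "s \<ge> -1")
    case True
    with I_add[of s t] that show ?thesis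
      by (simp add: Henstock_Kurzweil_Integration.integral_nonneg I_int B_nn)
  next
    case False
    then have "I s = 0" by (intro I_0) auto
    then show ?thesis
      unfolding I_def using B_nn I_int by (simp add: Henstock_Kurzweil_Integration.integral_nonneg)
  qed
  have I_deriv: "(I has_real_derivative B 0 t) (at t)" for t
  proof (cases "t > -1")
    case True
    have "(I has_real_derivative B 0 t) (at t within {-1..t + 1})"
      unfolding I_def using True by (intro integral_has_real_derivative B_cont) auto
    moreover have "at t within {-1..t + 1} = at t"
      using True by (intro at_within_interior) auto
    ultimately show ?thesis by simp
  next
    case False
    have "((\<lambda>_. 0) has_real_derivative B 0 t) (at t)"
      using False by (simp add: B_out)
    then show ?thesis
      by (rule has_field_derivative_transform_within_open[of _ _ _ "{..<0}"]) (use False I_0 in auto)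
  qed
  obtain z where "1/4 < z" "z < 3/4" "I (3/4) - I (1/4) = (3/4 - 1/4) * B 0 z"
    using MVT2[of "1/4" "3/4" I "B 0"] I_deriv by auto
  with B_pos[of z] have "I (3/4) > I (1/4)"
    by simp
  then have I1_pos: "I 1 > 0"
    using I_mono[of "3/4" 1] I_mono[of 0 "1/4"] I_0[of 0] by auto
  define \<theta> where "\<theta> = (\<lambda>k t. (case k of 0 \<Rightarrow> I t | Suc j \<Rightarrow> B j t) / I 1)"
  have \<theta>: "derivative_sequence \<theta>"
    unfolding derivative_sequence_def
  proof (intro allI)
    fix k t
    show "(\<theta> k has_real_derivative \<theta> (Suc k) t) (at t)"
      unfolding \<theta>_def
      by (cases k) (auto intro!: DERIV_cdivide I_deriv derivative_sequenceD[OF B(1)])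
  qed
  have "\<theta> 0 t = 0" if "t \<le> 0" for t
    using I_0[OF that] by (simp add: \<theta>_def)
  moreover have one: "\<theta> 0 t = 1" if "t \<ge> 1" for t
    using I_1[OF that] I1_pos by (simp add: \<theta>_def)
  moreover have \<theta>01: "0 \<le> \<theta> 0 t \<and> \<theta> 0 t \<le> 1" for t
  proof
    show "0 \<le> \<theta> 0 t"
      using I_mono[of "min t 0" t] I_0[of "min t 0"] I1_pos by (simp add: \<theta>_def)
    show "\<theta> 0 t \<le> 1"
      using I_mono[of t "max t 1"] I_1[of "max t 1"] I1_pos by (simp add: \<theta>_def)
  qed
  moreover have "\<exists>M. \<forall>t. \<bar>\<theta> k t\<bar> \<le> M" for k
  proof (cases k)
    case 0
    then show ?thesis using \<theta>01 by (intro exI[of _ 1]) (simp add: abs_le_iff)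
  next
    case (Suc j)
    have B_out': "B i t = 0" if "t \<notin> {0..1}" for i t
      using that
    proof (induction i arbitrary: t)
      case 0
      then show ?case by (intro B_out) auto
    next
      case (Suc i)
      have "((\<lambda>_. 0) has_real_derivative 0) (at t)" by simp
      then have "(B i has_real_derivative 0) (at t)"
        by (rule has_field_derivative_transform_within_open[of _ _ _ "- {0..1}"])
          (use Suc in \<open>auto simp: open_Compl\<close>)
      then show ?case
        using DERIV_unique derivative_sequenceD[OF B(1)] by blast
    qed
    have "bounded (B j ` {0..1})"
      by (intro compact_imp_bounded compact_continuous_image B_cont) auto
    then obtain M where M: "\<And>t. t \<in> {0..1} \<Longrightarrow> \<bar>B j t\<bar> \<le> M"
      unfolding bounded_iff real_norm_def by blast
    have "\<bar>B j t\<bar> \<le> max M 0" for t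
      using M[of t] B_out'[of t j] by (cases "t \<in> {0..1}") auto
    then have "\<bar>\<theta> k t\<bar> \<le> max M 0 / I 1" for t
      using I1_pos by (simp add: \<theta>_def Suc divide_right_mono)
    then show ?thesis by blast
  qed
  ultimately show thesis using that \<theta> by blast
qed

section \<open>Cut-off functions on cubes\<close>

text \<open>
  With a smooth step \<open>\<theta>\<close> and \<open>d = R - r\<close>, the cut-off is
  \<open>\<theta> ((R - t) / d) + \<theta> ((R + t) / d) - 1\<close>. Since one of the two steps is
  always 1 on the support, a sum serves as well as a product, and its derivatives scale like powers of
  \<open>1 / d\<close>.
\<close>

lemma interval_cutoff:
  obtains M :: "nat \<Rightarrow> real" where "\<And>k. M k \<ge> 0"
    "\<And>r R. 0 < r \<Longrightarrow> r < R \<Longrightarrow> \<exists>H. derivative_sequence H \<and>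
       (\<forall>t. 0 \<le> H 0 t \<and> H 0 t \<le> 1) \<and> (\<forall>t. \<bar>t\<bar> \<le> r \<longrightarrow> H 0 t = 1) \<and>
       (\<forall>k t. \<bar>t\<bar> > R \<longrightarrow> H k t = 0) \<and> (\<forall>k t. \<bar>H k t\<bar> \<le> M k / (R - r) ^ k)"
proof -
  obtain \<theta> where \<theta>: "derivative_sequence \<theta>"
    "\<And>t. t \<le> 0 \<Longrightarrow> \<theta> 0 t = 0" "\<And>t. t \<ge> 1 \<Longrightarrow> \<theta> 0 t = 1"
    "\<And>t. 0 \<le> \<theta> 0 t \<and> \<theta> 0 t \<le> 1" "\<And>k. \<exists>M. \<forall>t. \<bar>\<theta> k t\<bar> \<le> M"
    by (rule smooth_step) blast
  then obtain N where N: "\<And>k t. \<bar>\<theta> k t\<bar> \<le> N k" by metis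
  have N0: "N k \<ge> 0" for k using N[of k 0] by linarith
  define M where "M = (\<lambda>k. 2 * N k + 1)"
  have "\<exists>H. derivative_sequence H \<and>
       (\<forall>t. 0 \<le> H 0 t \<and> H 0 t \<le> 1) \<and> (\<forall>t. \<bar>t\<bar> \<le> r \<longrightarrow> H 0 t = 1) \<and>
       (\<forall>k t. \<bar>t\<bar> > R \<longrightarrow> H k t = 0) \<and> (\<forall>k t. \<bar>H k t\<bar> \<le> M k / (R - r) ^ k)"
    if r: "0 < r" "r < R" for r R
  proof -
    define d where "d = R - r"
    have d: "d > 0" using r by (simp add: d_def)
    define H where "H = (\<lambda>k t. (- 1 / d) ^ k * \<theta> k ((- 1 / d) * t + R / d) +
        (1 / d) ^ k * \<theta> k ((1 / d) * t + R / d) - (if k = 0 then 1 else 0))"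
    have "((\<lambda>t. H k t) has_real_derivative
        (- 1 / d) ^ Suc k * \<theta> (Suc k) ((- 1 / d) * t + R / d) +
        (1 / d) ^ Suc k * \<theta> (Suc k) ((1 / d) * t + R / d) - 0) (at t)" for k t
      unfolding H_def
      by (intro DERIV_add DERIV_diff DERIV_const
          derivative_sequenceD[OF derivative_sequence_affine[OF \<theta>(1)]])
    then have H: "derivative_sequence H"
      unfolding derivative_sequence_def by (simp add: H_def)
    have H0: "H 0 t = \<theta> 0 ((R - t) / d) + \<theta> 0 ((R + t) / d) - 1" for t
      by (simp add: H_def diff_divide_distrib add_divide_distrib add.commute)
    have one: "\<theta> 0 ((R - t) / d) = 1" if "t \<le> r" for t
      using that d by (intro \<theta>) (simp add: d_def field_simps)
    have zero: "\<theta> 0 ((R - t) / d) = 0" if "t \<ge> R" for t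
      using that d by (intro \<theta>) (simp add: divide_nonpos_pos)
    have "0 \<le> H 0 t \<and> H 0 t \<le> 1" for t
    proof (cases "t \<le> r")
      case True
      then show ?thesis using one[of t] \<theta>(4)[of "(R + t) / d"] by (simp add: H0)
    next
      case False
      then show ?thesis using one[of "- t"] r \<theta>(4)[of "(R - t) / d"] by (simp add: H0)
    qed
    moreover have "H 0 t = 1" if "\<bar>t\<bar> \<le> r" for t
      using one[of t] one[of "- t"] that by (simp add: H0)
    moreover have "H k t = 0" if "\<bar>t\<bar> > R" for k t
      using that
    proof (induction k arbitrary: t)
      case 0
      then show ?case
        using one[of t] one[of "- t"] zero[of t] zero[of "- t"] r by (auto simp: H0 abs_if split: if_splits)
    next
      case (Suc k)
      have "(H k has_real_derivative 0) (at t)"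
      proof (rule has_field_derivative_transform_within_open)
        show "t \<in> - {- R..R}" using Suc.prems by auto
        show "0 = H k x" if "x \<in> - {- R..R}" for x
          using Suc.IH[of x] that by fastforce
      qed auto
      then show ?case
        using DERIV_unique derivative_sequenceD[OF H] by blast
    qed
    moreover have "\<bar>H k t\<bar> \<le> M k / (R - r) ^ k" for k t
    proof -
      have *: "\<bar>s ^ k * \<theta> k x\<bar> \<le> N k / d ^ k" if "\<bar>s\<bar> = 1 / d" for s x
      proof -
        have "\<bar>s ^ k * \<theta> k x\<bar> = \<bar>\<theta> k x\<bar> / d ^ k"
          by (simp add: abs_mult power_abs that power_divide)
        also have "\<dots> \<le> N k / d ^ k"
          using d N by (intro divide_right_mono) auto
        finally show ?thesis .
      qed
      have "\<bar>H k t\<bar> \<le> N k / d ^ k + N k / d ^ k + (if k = 0 then 1 else 0)"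
        unfolding H_def
        by (rule order.trans[OF abs_triangle_ineq4], rule add_mono,
            rule order.trans[OF abs_triangle_ineq], intro add_mono *) (use d in auto)
      also have "\<dots> \<le> M k / d ^ k"
        using d by (simp add: M_def add_divide_distrib)
      finally show ?thesis by (simp add: d_def)
    qed
    ultimately show ?thesis using H by blast
  qed
  moreover have "M k \<ge> 0" for k using N0[of k] by (simp add: M_def)
  ultimately show thesis using that by blast
qed

lemma iterated_partial_prod:
  fixes H :: "nat \<Rightarrow> real \<Rightarrow> real" and js :: "'n::finite list"
  assumes H: "derivative_sequence H"
  shows "iterated_partial js (\<lambda>x. \<Prod>i\<in>UNIV. H 0 (x $ i)) =
    (\<lambda>x. \<Prod>i\<in>UNIV. H (count_list js i) (x $ i))"
    and "((\<lambda>t. \<Prod>i\<in>UNIV. H (count_list js i) ((x + t *\<^sub>R axis j 1) $ i)) has_real_derivative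
      (\<Prod>i\<in>UNIV. H (count_list (j # js) i) (x $ i))) (at 0)"
proof -
  have *: "((\<lambda>t. \<Prod>i\<in>UNIV. H (count_list js i) ((x + t *\<^sub>R axis j 1) $ i)) has_real_derivative
      (\<Prod>i\<in>UNIV. H (count_list (j # js) i) (x $ i))) (at 0)" for js and j :: 'n and x
  proof -
    define P where "P = (\<Prod>i\<in>UNIV - {j}. H (count_list js i) (x $ i))"
    have 1: "(\<Prod>i\<in>UNIV. H (count_list js i) ((x + t *\<^sub>R axis j 1) $ i)) =
        H (count_list js j) (x $ j + t) * P" for t
      unfolding P_def
      by (subst prod.remove[of _ j]) (auto simp: axis_def intro!: prod.cong)
    have 2: "(\<Prod>i\<in>UNIV. H (count_list (j # js) i) (x $ i)) = H (Suc (count_list js j)) (x $ j) * P"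
      unfolding P_def
      by (subst prod.remove[of _ j]) (auto intro!: prod.cong)
    have "((\<lambda>t. H (count_list js j) (x $ j + t)) has_real_derivative
        H (Suc (count_list js j)) (x $ j + 0)) (at 0)"
      using DERIV_at_within_shift[of "H (count_list js j)" _ "x $ j" 0 UNIV]
        derivative_sequenceD[OF H, of "count_list js j" "x $ j"]
      by simp
    from DERIV_cmult_right[OF this, of P] show ?thesis
      unfolding 1 2 by simp
  qed
  show "((\<lambda>t. \<Prod>i\<in>UNIV. H (count_list js i) ((x + t *\<^sub>R axis j 1) $ i)) has_real_derivative
      (\<Prod>i\<in>UNIV. H (count_list (j # js) i) (x $ i))) (at 0)"
    by (rule *)
  show "iterated_partial js (\<lambda>x. \<Prod>i\<in>UNIV. H 0 (x $ i)) =
    (\<lambda>x. \<Prod>i\<in>UNIV. H (count_list js i) (x $ i))"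
  proof (induction js)
    case (Cons j js)
    show ?case
      unfolding iterated_partial.simps Cons.IH partial_deriv_def
      by (rule ext, rule DERIV_imp_deriv, rule *)
  qed simp
qed

lemma multi_partial_prod:
  fixes \<alpha> :: "'n::finite \<Rightarrow> nat"
  assumes "derivative_sequence H"
  shows "multi_partial \<alpha> (\<lambda>x. \<Prod>i\<in>UNIV. H 0 (x $ i)) = (\<lambda>x. \<Prod>i\<in>UNIV. H (\<alpha> i) (x $ i))"
proof -
  have "\<forall>i. count_list (SOME js. \<forall>i. count_list js i = \<alpha> i) i = \<alpha> i"
    by (rule someI_ex[OF ex_list_of_multi_index])
  then show ?thesis
    unfolding multi_partial_def iterated_partial_prod(1)[OF assms] by simp
qed

lemma smooth_prod:
  assumes "derivative_sequence H"
  shows "smooth (\<lambda>x :: real ^ 'n::finite. \<Prod>i\<in>UNIV. H 0 (x $ i))"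
proof -
  have "continuous_on UNIV (H k)" for k
    by (intro continuous_at_imp_continuous_on ballI DERIV_isCont[OF derivative_sequenceD[OF assms]])
  then have "continuous_on UNIV (\<lambda>x :: real ^ 'n. H k (x $ i))" for k i
    by (rule continuous_on_compose2) (auto intro!: continuous_intros)
  then show ?thesis
    unfolding smooth_def iterated_partial_prod(1)[OF assms]
    using iterated_partial_prod(2)[OF assms] real_differentiable_def
    by (auto intro!: continuous_on_prod) blast
qed

text \<open>
  The closed cube with centre 0 and half-side \<open>r\<close>. Cubes take the place of balls because their
  cut-off functions are products of functions of one coordinate.
\<close>

definition cube :: "real \<Rightarrow> (real ^ 'n::finite) set" where
  "cube r = cbox (\<chi> i. - r) (\<chi> i. r)"

lemma mem_cube: "x \<in> cube r \<longleftrightarrow> (\<forall>i. \<bar>x $ i\<bar> \<le> r)"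
  by (auto simp: cube_def mem_box_cart abs_le_iff minus_le_iff)

lemma cube_mono: "r \<le> R \<Longrightarrow> cube r \<subseteq> cube R"
  by (meson mem_cube order.trans subsetI)

lemma compact_cube: "compact (cube r)"
  by (simp add: cube_def)

lemma cube_cutoff:
  obtains C where "C \<ge> 0"
    "\<And>r R. 0 < r \<Longrightarrow> r < R \<Longrightarrow> \<exists>\<phi> :: real ^ 'n::finite \<Rightarrow> real. test_function \<phi> \<and>
       (\<forall>x. 0 \<le> \<phi> x \<and> \<phi> x \<le> 1) \<and> (\<forall>x\<in>cube r. \<phi> x = 1) \<and> (\<forall>x. x \<notin> cube R \<longrightarrow> \<phi> x = 0) \<and>
       (\<forall>\<alpha>\<in>multi_indices m. \<forall>x. \<bar>multi_partial \<alpha> \<phi> x\<bar> \<le> C / (R - r) ^ m * indicator (cube R) x)"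
proof -
  obtain M :: "nat \<Rightarrow> real" where M: "\<And>k. M k \<ge> 0"
    "\<And>r R. 0 < r \<Longrightarrow> r < R \<Longrightarrow> \<exists>H. derivative_sequence H \<and>
       (\<forall>t. 0 \<le> H 0 t \<and> H 0 t \<le> 1) \<and> (\<forall>t. \<bar>t\<bar> \<le> r \<longrightarrow> H 0 t = 1) \<and>
       (\<forall>k t. \<bar>t\<bar> > R \<longrightarrow> H k t = 0) \<and> (\<forall>k t. \<bar>H k t\<bar> \<le> M k / (R - r) ^ k)"
    by (rule interval_cutoff) blast
  define S where "S = (\<Sum>k\<le>m. M k)"
  have S: "M k \<le> S" if "k \<le> m" for k
    unfolding S_def using that M(1) by (intro member_le_sum) auto
  have S0: "S \<ge> 0" using M(1) by (auto simp: S_def intro: sum_nonneg)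
  define C where "C = S ^ CARD('n)"
  have "\<exists>\<phi> :: real ^ 'n \<Rightarrow> real. test_function \<phi> \<and>
       (\<forall>x. 0 \<le> \<phi> x \<and> \<phi> x \<le> 1) \<and> (\<forall>x\<in>cube r. \<phi> x = 1) \<and> (\<forall>x. x \<notin> cube R \<longrightarrow> \<phi> x = 0) \<and>
       (\<forall>\<alpha>\<in>multi_indices m. \<forall>x. \<bar>multi_partial \<alpha> \<phi> x\<bar> \<le> C / (R - r) ^ m * indicator (cube R) x)"
    if r: "0 < r" "r < R" for r R
  proof -
    obtain H where H: "derivative_sequence H" "\<And>t. 0 \<le> H 0 t" "\<And>t. H 0 t \<le> 1"
      "\<And>t. \<bar>t\<bar> \<le> r \<Longrightarrow> H 0 t = 1" "\<And>k t. \<bar>t\<bar> > R \<Longrightarrow> H k t = 0"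
      "\<And>k t. \<bar>H k t\<bar> \<le> M k / (R - r) ^ k"
      using M(2)[OF r] by blast
    define \<phi> :: "real ^ 'n \<Rightarrow> real" where "\<phi> = (\<lambda>x. \<Prod>i\<in>UNIV. H 0 (x $ i))"
    have out: "(\<Prod>i\<in>UNIV. H (c i) (x $ i)) = 0" if "x \<notin> cube R" for c and x :: "real ^ 'n"
      using that H(5) by (force simp: mem_cube not_le)
    have zero: "\<phi> x = 0" if "x \<notin> cube R" for x
      unfolding \<phi>_def by (rule out[OF that])
    then have "{x. \<phi> x \<noteq> 0} \<subseteq> cube R" by blast
    then have "bounded {x. \<phi> x \<noteq> 0}"
      using bounded_subset compact_imp_bounded compact_cube by blast
    then have "test_function \<phi>"
      using smooth_prod[OF H(1)] by (simp add: test_function_def \<phi>_def)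
    moreover have "0 \<le> \<phi> x \<and> \<phi> x \<le> 1" for x
      unfolding \<phi>_def using H(2,3) by (auto intro: prod_nonneg prod_le_1)
    moreover have "\<phi> x = 1" if "x \<in> cube r" for x
      unfolding \<phi>_def using H(4) that by (auto simp: mem_cube)
    moreover have "\<bar>multi_partial \<alpha> \<phi> x\<bar> \<le> C / (R - r) ^ m * indicator (cube R) x"
      if \<alpha>: "\<alpha> \<in> multi_indices m" for \<alpha> x
    proof (cases "x \<in> cube R")
      case False
      then show ?thesis using out[of x \<alpha>] by (simp add: \<phi>_def multi_partial_prod[OF H(1)])
    next
      case True
      have le: "\<alpha> i \<le> m" for i
        using \<alpha> member_le_sum[of i UNIV \<alpha>] by (simp add: multi_indices_def)
      have "\<bar>multi_partial \<alpha> \<phi> x\<bar> = (\<Prod>i\<in>UNIV. \<bar>H (\<alpha> i) (x $ i)\<bar>)"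
        by (simp add: \<phi>_def multi_partial_prod[OF H(1)] abs_prod)
      also have "\<dots> \<le> (\<Prod>i\<in>UNIV. S / (R - r) ^ \<alpha> i)"
        by (intro prod_mono conjI order.trans[OF H(6)] divide_right_mono S le) (use r in auto)
      also have "\<dots> = C / (\<Prod>i\<in>UNIV. (R - r) ^ \<alpha> i)"
        by (simp add: prod_dividef C_def)
      also have "(\<Prod>i\<in>UNIV. (R - r) ^ \<alpha> i) = (R - r) ^ m"
        using \<alpha> by (simp add: multi_indices_def flip: power_sum)
      finally show ?thesis using True by simp
    qed
    ultimately show ?thesis using zero by blast
  qed
  moreover have "C \<ge> 0" using S0 by (simp add: C_def)
  ultimately show thesis using that by blast
qed

section \<open>Integral estimates on cubes\<close>

lemma finite_multi_indices: "finite (multi_indices m :: ('n::finite \<Rightarrow> nat) set)"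
proof (rule finite_subset)
  have "\<alpha> i \<le> sum \<alpha> UNIV" for \<alpha> :: "'n \<Rightarrow> nat" and i
    by (rule member_le_sum) auto
  then show "multi_indices m \<subseteq> (UNIV :: 'n set) \<rightarrow>\<^sub>E {..m}"
    by (auto simp: multi_indices_def)
qed (simp add: finite_PiE)

lemma multi_indices_nonempty: "multi_indices m \<noteq> ({} :: ('n::finite \<Rightarrow> nat) set)"
proof -
  obtain i :: 'n where True by blast
  have "(\<lambda>j. if j = i then m else 0) \<in> multi_indices m"
    by (simp add: multi_indices_def)
  then show ?thesis by blast
qed

lemma sets_cube [measurable, simp]: "cube r \<in> sets lebesgue"
  by (simp add: cube_def)

lemma locally_integrable_cube:
  "locally_integrable u \<Longrightarrow> set_integrable lebesgue (cube r) u"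
  by (simp add: locally_integrable_def compact_cube)

lemma set_integrable_abs_cube:
  "locally_integrable u \<Longrightarrow> set_integrable lebesgue (cube r) (\<lambda>x. \<bar>u x\<bar>)"
  by (intro set_integrable_abs locally_integrable_cube)

lemma measure_cube: "r \<ge> 0 \<Longrightarrow> measure lebesgue (cube r :: (real ^ 'n::finite) set) = (2 * r) ^ CARD('n)"
  by (simp add: cube_def content_cbox_cart interval_ne_empty_cart)

lemma set_integral_cube_mono:
  fixes u :: "real ^ 'n::finite \<Rightarrow> real"
  assumes "locally_integrable u" "\<And>x. u x \<ge> 0" "r \<le> R"
  shows "(LINT x:cube r|lebesgue. u x) \<le> (LINT x:cube R|lebesgue. u x)"
  unfolding set_lebesgue_integral_def
  using assms cube_mono[OF assms(3)] locally_integrable_cube[OF assms(1)]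
  by (intro integral_mono) (auto simp: set_integrable_def indicator_def)

text \<open>
  Testing with a cut-off that is 1 on the inner cube. The derivatives of order \<open>m\<close> that fall on it
  cost \<open>(R - r) ^ (- m)\<close>. No measurability of \<open>a\<close> is needed: were the right-hand integrand
  not integrable, its Bochner integral would be 0, which also satisfies the bound.
\<close>

lemma cube_integral_estimate:
  fixes a :: "('n::finite \<Rightarrow> nat) \<Rightarrow> real ^ 'n \<Rightarrow> real \<Rightarrow> real" and u F :: "real ^ 'n \<Rightarrow> real"
  assumes A: "A \<ge> 0"
    and growth: "\<And>\<alpha>. \<alpha> \<in> multi_indices m \<Longrightarrow> AE x in lebesgue. \<forall>\<zeta>. \<bar>a \<alpha> x \<zeta>\<bar> \<le> A * \<bar>\<zeta>\<bar>"
    and u: "locally_integrable u" and F: "locally_integrable F" "\<And>x. F x \<ge> 0"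
    and ineq: "\<And>\<phi>. test_function \<phi> \<Longrightarrow> (\<And>x. \<phi> x \<ge> 0) \<Longrightarrow>
      (\<integral>x. F x * \<phi> x \<partial>lebesgue) \<le>
      (-1) ^ m * (\<integral>x. (\<Sum>\<alpha>\<in>multi_indices m. a \<alpha> x (u x) * multi_partial \<alpha> \<phi> x) \<partial>lebesgue)"
  obtains C where "C \<ge> 0"
    "\<And>r R. 0 < r \<Longrightarrow> r < R \<Longrightarrow>
      (R - r) ^ m * (LINT x:cube r|lebesgue. F x) \<le> C * (LINT x:cube R|lebesgue. \<bar>u x\<bar>)"
proof -
  obtain D where D: "D \<ge> 0"
    "\<And>r R. 0 < r \<Longrightarrow> r < R \<Longrightarrow> \<exists>\<phi> :: real ^ 'n \<Rightarrow> real. test_function \<phi> \<and>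
       (\<forall>x. 0 \<le> \<phi> x \<and> \<phi> x \<le> 1) \<and> (\<forall>x\<in>cube r. \<phi> x = 1) \<and> (\<forall>x. x \<notin> cube R \<longrightarrow> \<phi> x = 0) \<and>
       (\<forall>\<alpha>\<in>multi_indices m. \<forall>x. \<bar>multi_partial \<alpha> \<phi> x\<bar> \<le> D / (R - r) ^ m * indicator (cube R) x)"
    by (rule cube_cutoff) blast
  define N where "N = real (card (multi_indices m :: ('n \<Rightarrow> nat) set))"
  have "(R - r) ^ m * (LINT x:cube r|lebesgue. F x) \<le> (N * A * D) * (LINT x:cube R|lebesgue. \<bar>u x\<bar>)"
    if r: "0 < r" "r < R" for r R
  proof -
    obtain \<phi> :: "real ^ 'n \<Rightarrow> real" where \<phi>: "test_function \<phi>" "\<And>x. 0 \<le> \<phi> x" "\<And>x. \<phi> x \<le> 1"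
      "\<And>x. x \<in> cube r \<Longrightarrow> \<phi> x = 1" "\<And>x. x \<notin> cube R \<Longrightarrow> \<phi> x = 0"
      "\<And>\<alpha> x. \<alpha> \<in> multi_indices m \<Longrightarrow> \<bar>multi_partial \<alpha> \<phi> x\<bar> \<le> D / (R - r) ^ m * indicator (cube R) x"
      using D(2)[OF r] by blast
    have "continuous_on UNIV (iterated_partial [] \<phi>)"
      using \<phi>(1) unfolding test_function_def smooth_def by blast
    then have meas: "\<phi> \<in> borel_measurable lebesgue"
      by (simp add: borel_measurable_continuous_onI measurable_completion)
    have F_int: "integrable lebesgue (\<lambda>x. indicator (cube R) x *\<^sub>R F x)" for R
      using locally_integrable_cube[OF F(1)] by (simp add: set_integrable_def)
    have "integrable lebesgue (\<lambda>x. F x * \<phi> x)"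
    proof (rule Bochner_Integration.integrable_bound[OF F_int[of R]])
      have "(\<lambda>x. (indicator (cube R) x *\<^sub>R F x) * \<phi> x) \<in> borel_measurable lebesgue"
        using F_int[of R] meas by (intro borel_measurable_times) auto
      moreover have "(\<lambda>x. (indicator (cube R) x *\<^sub>R F x) * \<phi> x) = (\<lambda>x. F x * \<phi> x)"
        using \<phi>(5) by (fastforce simp: indicator_def)
      ultimately show "(\<lambda>x. F x * \<phi> x) \<in> borel_measurable lebesgue" by simp
      show "AE x in lebesgue. norm (F x * \<phi> x) \<le> norm (indicator (cube R) x *\<^sub>R F x)"
        using \<phi>(2,3,5) F(2) by (intro AE_I2) (auto simp: indicator_def abs_mult mult_left_le)
    qed
    then have "(LINT x:cube r|lebesgue. F x) \<le> (\<integral>x. F x * \<phi> x \<partial>lebesgue)"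
      unfolding set_lebesgue_integral_def
      using \<phi>(2,4) F(2) F_int[of r] by (intro integral_mono) (auto simp: indicator_def)
    also have "\<dots> \<le> (-1) ^ m * (\<integral>x. (\<Sum>\<alpha>\<in>multi_indices m. a \<alpha> x (u x) * multi_partial \<alpha> \<phi> x) \<partial>lebesgue)"
      by (intro ineq \<phi>)
    also have "\<dots> = (\<integral>x. (-1) ^ m * (\<Sum>\<alpha>\<in>multi_indices m. a \<alpha> x (u x) * multi_partial \<alpha> \<phi> x) \<partial>lebesgue)"
      by simp
    also have "\<dots> \<le> (\<integral>x. (N * A * (D / (R - r) ^ m)) * (indicator (cube R) x *\<^sub>R \<bar>u x\<bar>) \<partial>lebesgue)"
    proof (rule integral_mono_AE')
      show "integrable lebesgue (\<lambda>x. (N * A * (D / (R - r) ^ m)) * (indicator (cube R) x *\<^sub>R \<bar>u x\<bar>))"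
        using set_integrable_abs_cube[OF u, of R] by (auto simp: set_integrable_def)
      have nn: "0 \<le> N * A * (D / (R - r) ^ m)"
        using A D(1) r by (simp add: N_def)
      then show "AE x in lebesgue. 0 \<le> (N * A * (D / (R - r) ^ m)) * (indicator (cube R) x *\<^sub>R \<bar>u x\<bar>)"
        by (intro AE_I2 mult_nonneg_nonneg[of "N * A * (D / (R - r) ^ m)"]) auto
      have "AE x in lebesgue. \<forall>\<alpha>\<in>multi_indices m. \<forall>\<zeta>. \<bar>a \<alpha> x \<zeta>\<bar> \<le> A * \<bar>\<zeta>\<bar>"
        using growth by (intro AE_finite_allI finite_multi_indices) auto
      then show "AE x in lebesgue. (-1) ^ m * (\<Sum>\<alpha>\<in>multi_indices m. a \<alpha> x (u x) * multi_partial \<alpha> \<phi> x)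
          \<le> (N * A * (D / (R - r) ^ m)) * (indicator (cube R) x *\<^sub>R \<bar>u x\<bar>)"
      proof eventually_elim
        case (elim x)
        have "(-1) ^ m * (\<Sum>\<alpha>\<in>multi_indices m. a \<alpha> x (u x) * multi_partial \<alpha> \<phi> x) \<le>
            \<bar>\<Sum>\<alpha>\<in>multi_indices m. a \<alpha> x (u x) * multi_partial \<alpha> \<phi> x\<bar>"
          by (cases "even m") auto
        also have "\<dots> \<le> (\<Sum>\<alpha>\<in>multi_indices m. \<bar>a \<alpha> x (u x) * multi_partial \<alpha> \<phi> x\<bar>)"
          by (rule sum_abs)
        also have "\<dots> \<le> (\<Sum>\<alpha>\<in>(multi_indices m :: ('n \<Rightarrow> nat) set). A * \<bar>u x\<bar> * (D / (R - r) ^ m * indicator (cube R) x))"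
          unfolding abs_mult using elim \<phi>(6) A by (intro sum_mono mult_mono) auto
        also have "\<dots> = (N * A * (D / (R - r) ^ m)) * (indicator (cube R) x *\<^sub>R \<bar>u x\<bar>)"
          by (simp add: N_def mult_ac)
        finally show ?case .
      qed
    qed
    also have "\<dots> = N * A * D * (LINT x:cube R|lebesgue. \<bar>u x\<bar>) / (R - r) ^ m"
      by (simp add: set_lebesgue_integral_def)
    finally show ?thesis
      using r by (simp add: field_simps)
  qed
  moreover have "N * A * D \<ge> 0" using A D(1) by (simp add: N_def)
  ultimately show thesis using that by blast
qed

lemma convex_mono_supporting_line:
  fixes f :: "real \<Rightarrow> real"
  assumes "convex_on {0..} f" "mono_on {0..} f" "c \<ge> 0"
  obtains k where "\<And>y. y \<ge> 0 \<Longrightarrow> f y \<ge> f c + k * (y - c)"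
proof -
  \<comment> \<open>The even extension of a non-decreasing convex function is convex on the whole line, so it has a supporting line at 0 as well.\<close>
  have "convex_on UNIV (\<lambda>y. f \<bar>y\<bar>)"
  proof (rule convex_onI)
    fix t x y :: real assume t: "0 < t" "t < 1"
    have "f \<bar>(1 - t) *\<^sub>R x + t *\<^sub>R y\<bar> \<le> f ((1 - t) *\<^sub>R \<bar>x\<bar> + t *\<^sub>R \<bar>y\<bar>)"
    proof (rule mono_onD[OF assms(2)])
      show "\<bar>(1 - t) *\<^sub>R x + t *\<^sub>R y\<bar> \<le> (1 - t) *\<^sub>R \<bar>x\<bar> + t *\<^sub>R \<bar>y\<bar>"
        using t by (intro order.trans[OF abs_triangle_ineq]) (simp add: abs_mult)
    qed (use t in auto)
    also have "\<dots> \<le> (1 - t) * f \<bar>x\<bar> + t * f \<bar>y\<bar>"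
      using t by (intro convex_onD[OF assms(1)]) auto
    finally show "f \<bar>(1 - t) *\<^sub>R x + t *\<^sub>R y\<bar> \<le> (1 - t) * f \<bar>x\<bar> + t * f \<bar>y\<bar>" .
  qed simp
  then obtain k where "\<And>y. f \<bar>y\<bar> \<ge> f \<bar>c\<bar> + k * (y - c)"
    using convex_le_Inf_differential[of UNIV "\<lambda>y. f \<bar>y\<bar>" c] by auto
  then have "f y \<ge> f c + k * (y - c)" if "y \<ge> 0" for y
    using assms(3) that by (metis abs_of_nonneg)
  then show thesis by (rule that)
qed

text \<open>
  Jensen's inequality for the mean of \<open>\<bar>u\<bar>\<close> over a cube; \<open>(2 * r) ^ CARD('n)\<close>
  is the volume of the cube.
\<close>

lemma Jensen_cube:
  fixes u :: "real ^ 'n::finite \<Rightarrow> real"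
  assumes f: "convex_on {0..} f" "mono_on {0..} f" and r: "r > 0"
    and u: "locally_integrable u" "locally_integrable (\<lambda>x. f \<bar>u x\<bar>)"
  shows "(2 * r) ^ CARD('n) * f ((LINT x:cube r|lebesgue. \<bar>u x\<bar>) / (2 * r) ^ CARD('n))
    \<le> (LINT x:cube r|lebesgue. f \<bar>u x\<bar>)"
proof -
  define V where "V = (2 * r) ^ CARD('n)"
  define c where "c = (LINT x:cube r|lebesgue. \<bar>u x\<bar>) / V"
  have V: "V > 0" using r by (simp add: V_def)
  have "(LINT x:cube r|lebesgue. \<bar>u x\<bar>) \<ge> 0"
    unfolding set_lebesgue_integral_def by (intro Bochner_Integration.integral_nonneg) auto
  then have "c \<ge> 0" using V by (simp add: c_def)
  then obtain k where k: "\<And>y. y \<ge> 0 \<Longrightarrow> f y \<ge> f c + k * (y - c)"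
    using convex_mono_supporting_line[OF f] by blast
  have const: "set_integrable lebesgue (cube r :: (real ^ 'n) set) (\<lambda>x. b)" for b :: real
    unfolding set_integrable_def cube_def
    by (intro integrable_scaleR_left integrable_real_indicator) (use emeasure_lborel_cbox_finite in auto)
  have const': "(LINT x:(cube r :: (real ^ 'n) set)|lebesgue. b) = b * V" for b :: real
    using r by (simp add: set_lebesgue_integral_def measure_cube V_def)
  have eq: "V * f c = (LINT x:cube r|lebesgue. (f c - k * c) + k * \<bar>u x\<bar>)"
    using V by (subst set_integral_add) (auto simp: const const' set_integrable_abs_cube u c_def field_simps)
  have "f c - k * c + k * \<bar>u x\<bar> \<le> f \<bar>u x\<bar>" for x
    using k[of "\<bar>u x\<bar>"] by (simp add: algebra_simps)
  then have "(LINT x:cube r|lebesgue. (f c - k * c) + k * \<bar>u x\<bar>) \<le> (LINT x:cube r|lebesgue. f \<bar>u x\<bar>)"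
    by (intro set_integral_mono set_integral_add const set_integrable_mult_right
        set_integrable_abs_cube u locally_integrable_cube)
  with eq show ?thesis by (simp add: c_def V_def)
qed

lemma AE_zero_if_cube_integrals_zero:
  fixes F :: "real ^ 'n::finite \<Rightarrow> real"
  assumes "locally_integrable F" "\<And>x. F x \<ge> 0" "\<And>r. r > 0 \<Longrightarrow> (LINT x:cube r|lebesgue. F x) \<le> 0"
  shows "AE x in lebesgue. F x = 0"
proof -
  have "AE x in lebesgue. indicator (cube (real (Suc k))) x *\<^sub>R F x = 0" for k
  proof -
    have "(LINT x:cube (real (Suc k))|lebesgue. F x) = 0"
      using assms(2) assms(3)[of "real (Suc k)"]
      by (intro antisym) (auto simp: set_lebesgue_integral_def intro!: Bochner_Integration.integral_nonneg)
    then show ?thesis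
      using locally_integrable_cube[OF assms(1), of "real (Suc k)"] assms(2)
      unfolding set_lebesgue_integral_def set_integrable_def
      by (subst (asm) integral_nonneg_eq_0_iff_AE) auto
  qed
  then have "AE x in lebesgue. \<forall>k. indicator (cube (real (Suc k))) x *\<^sub>R F x = 0"
    by (subst AE_all_countable) auto
  then show ?thesis
  proof eventually_elim
    case (elim x)
    obtain k where "norm x \<le> real k" using real_arch_simple by blast
    then have "\<bar>x $ i\<bar> \<le> real (Suc k)" for i
      using component_le_norm_cart[of x i] by simp
    then have "x \<in> cube (real (Suc k))"
      by (simp add: mem_cube)
    with elim[rule_format, of k] show ?case by simp
  qed
qed

section \<open>The inequalities for the averages\<close>

text \<open>
  Cauchy condensation for an integral with a non-increasing integrand.
\<close>

lemma summable_dyadic_if_nn_integral_finite: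
  fixes W :: "real \<Rightarrow> real"
  assumes nonneg: "\<And>x. W x \<ge> 0" and anti: "\<And>x y. 1 \<le> x \<Longrightarrow> x \<le> y \<Longrightarrow> W y \<le> W x"
    and fin: "(\<integral>\<^sup>+\<zeta>\<in>{1..}. ennreal (W \<zeta>) \<partial>lborel) < \<infinity>" and w: "w \<ge> 2"
  shows "summable (\<lambda>k. (2 ^ k * w) * W (2 ^ k * w))"
proof -
  define I where "I = (\<integral>\<^sup>+\<zeta>\<in>{1..}. ennreal (W \<zeta>) \<partial>lborel)"
  define \<omega> where "\<omega> = (\<lambda>k::nat. 2 ^ k * w)"
  \<comment> \<open>On the interval of length \<open>\<omega> k / 2\<close> below \<open>\<omega> k\<close>, \<open>W\<close> is at least \<open>W (\<omega> k)\<close>.\<close>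
  define J where "J = (\<lambda>k. {\<omega> k / 2<..\<omega> k})"
  have \<omega>2: "\<omega> k \<ge> 2" for k
    using mult_mono[of 1 "2 ^ k" 2 w] w by (simp add: \<omega>_def)
  have disj: "k = j" if "\<zeta> \<in> J k" "\<zeta> \<in> J j" for \<zeta> k j
  proof -
    have "\<not> a < b" if "\<zeta> \<in> J a" "\<zeta> \<in> J b" for a b
    proof
      assume "a < b"
      then have "\<omega> (Suc a) \<le> \<omega> b"
        unfolding \<omega>_def using w by (intro mult_right_mono power_increasing) auto
      with that show False by (simp add: J_def \<omega>_def)
    qed
    from this[of k j] this[of j k] that show ?thesis by force
  qed
  have "(\<Sum>k<N. ennreal (\<omega> k / 2 * W (\<omega> k))) \<le> I" for N
  proof -
    have "(\<Sum>k<N. ennreal (\<omega> k / 2 * W (\<omega> k))) =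
        (\<Sum>k<N. \<integral>\<^sup>+\<zeta>. ennreal (W (\<omega> k)) * indicator (J k) \<zeta> \<partial>lborel)"
    proof (rule sum.cong[OF refl])
      fix k
      have "emeasure lborel (J k) = ennreal (\<omega> k / 2)"
        using \<omega>2[of k] by (simp add: J_def)
      then show "ennreal (\<omega> k / 2 * W (\<omega> k)) = (\<integral>\<^sup>+\<zeta>. ennreal (W (\<omega> k)) * indicator (J k) \<zeta> \<partial>lborel)"
        using nonneg \<omega>2[of k]
        by (simp add: nn_integral_cmult_indicator J_def mult.commute flip: ennreal_mult)
    qed
    also have "\<dots> = (\<integral>\<^sup>+\<zeta>. (\<Sum>k<N. ennreal (W (\<omega> k)) * indicator (J k) \<zeta>) \<partial>lborel)"
      by (rule nn_integral_sum[symmetric]) (simp add: J_def)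
    also have "\<dots> \<le> I"
      unfolding I_def
    proof (rule nn_integral_mono)
      fix \<zeta> :: real
      show "(\<Sum>k<N. ennreal (W (\<omega> k)) * indicator (J k) \<zeta>) \<le> ennreal (W \<zeta>) * indicator {1..} \<zeta>"
      proof (cases "\<exists>j<N. \<zeta> \<in> J j")
        case True
        then obtain j where j: "j < N" "\<zeta> \<in> J j" by blast
        have "\<zeta> \<in> J k \<longleftrightarrow> k = j" for k
          using j(2) disj by metis
        then have "(\<Sum>k<N. ennreal (W (\<omega> k)) * indicator (J k) \<zeta>) = (\<Sum>k<N. if k = j then ennreal (W (\<omega> k)) else 0)"
          by (intro sum.cong) (simp_all add: indicator_def)
        also have "\<dots> = ennreal (W (\<omega> j))" using j by simp
        also have "\<dots> \<le> ennreal (W \<zeta>) * indicator {1..} \<zeta>"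
          using j(2) \<omega>2[of j] anti[of \<zeta> "\<omega> j"] by (auto simp: J_def intro!: ennreal_leI)
        finally show ?thesis .
      next
        case False
        then show ?thesis by (simp add: indicator_def)
      qed
    qed
    finally show ?thesis .
  qed
  moreover have terms: "\<omega> k / 2 * W (\<omega> k) \<ge> 0" for k
    using \<omega>2[of k] nonneg by simp
  ultimately have "ennreal (\<Sum>k<N. \<omega> k / 2 * W (\<omega> k)) \<le> ennreal (enn2real I)" for N
    using fin by (simp only: sum_ennreal) (simp add: I_def)
  then have "(\<Sum>k<N. \<omega> k / 2 * W (\<omega> k)) \<le> enn2real I" for N
    by (subst (asm) ennreal_le_iff) auto
  with terms have "summable (\<lambda>k. \<omega> k / 2 * W (\<omega> k))"
    by (intro summableI_nonneg_bounded) auto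
  from summable_mult[OF this, of 2] show ?thesis
    by (simp add: \<omega>_def)
qed

lemma admissibleD:
  assumes "admissible_nonlinearity f lam mu g h"
  shows "lam \<ge> 1" and "\<zeta> \<ge> 1 \<Longrightarrow> g \<zeta> > 0"
    and "1 \<le> x \<Longrightarrow> x \<le> y \<Longrightarrow> g x \<le> g y" and "0 \<le> x \<Longrightarrow> x \<le> y \<Longrightarrow> f x \<le> f y"
    and "\<zeta> \<ge> 1 \<Longrightarrow> f \<zeta> \<ge> \<zeta> powr lam * g \<zeta>"
proof -
  show "lam \<ge> 1" "\<zeta> \<ge> 1 \<Longrightarrow> g \<zeta> > 0" "\<zeta> \<ge> 1 \<Longrightarrow> f \<zeta> \<ge> \<zeta> powr lam * g \<zeta>"
    using assms by (simp_all add: admissible_nonlinearity_def)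
  have "mono_on {1..} g" "mono_on {0..} f"
    using assms by (simp_all add: admissible_nonlinearity_def)
  then show "1 \<le> x \<Longrightarrow> x \<le> y \<Longrightarrow> g x \<le> g y" "0 \<le> x \<Longrightarrow> x \<le> y \<Longrightarrow> f x \<le> f y"
    by (simp_all add: mono_onD)
qed

lemma admissible_pos:
  assumes "admissible_nonlinearity f lam mu g h" "\<zeta> > 0"
  shows "f \<zeta> > 0"
proof (cases "\<zeta> \<ge> 1")
  case True
  with assms have "f \<zeta> \<ge> \<zeta> powr lam * g \<zeta>" "g \<zeta> > 0"
    by (auto simp: admissible_nonlinearity_def)
  moreover from this have "0 < \<zeta> powr lam * g \<zeta>" using assms(2) by simp
  ultimately show ?thesis by linarith
next
  case False
  with assms have "f \<zeta> \<ge> \<zeta> powr mu * h \<zeta>" "h \<zeta> > 0"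
    by (auto simp: admissible_nonlinearity_def)
  moreover from this have "0 < \<zeta> powr mu * h \<zeta>" using assms(2) by simp
  ultimately show ?thesis by linarith
qed

lemma admissible_ge_linear:
  assumes "admissible_nonlinearity f lam mu g h" "\<zeta> \<ge> 1"
  shows "f \<zeta> \<ge> \<zeta> * g 1"
proof -
  have "g 1 \<le> g \<zeta>" "g 1 > 0" "lam \<ge> 1" "f \<zeta> \<ge> \<zeta> powr lam * g \<zeta>"
    using admissibleD[OF assms(1)] assms(2) by auto
  moreover have "\<zeta> \<le> \<zeta> powr lam"
    using powr_mono[of 1 lam \<zeta>] assms(2) \<open>lam \<ge> 1\<close> by simp
  ultimately show ?thesis
    using assms(2) by (smt (verit) mult_mono)
qed

lemma admissible_sqrt:
  assumes "admissible_nonlinearity f lam mu g h"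
  obtains \<eta> w where "\<eta> > 0" "w \<ge> 1" "\<And>\<omega>. \<omega> \<ge> w \<Longrightarrow> g (\<omega> powr (1/2)) \<ge> \<eta> * g \<omega>"
proof -
  have "Liminf at_top (\<lambda>\<zeta>. ereal (g (\<zeta> powr (1/2)) / g \<zeta>)) > 0"
    using assms by (auto simp: admissible_nonlinearity_def)
  then obtain \<eta> where \<eta>: "0 < ereal \<eta>" "ereal \<eta> < Liminf at_top (\<lambda>\<zeta>. ereal (g (\<zeta> powr (1/2)) / g \<zeta>))"
    using ereal_dense2 by blast
  from less_LiminfD[OF \<eta>(2)] obtain w where
    w: "\<And>\<zeta>. \<zeta> \<ge> w \<Longrightarrow> \<eta> < g (\<zeta> powr (1/2)) / g \<zeta>"
    by (auto simp: eventually_at_top_linorder)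
  have "g (\<omega> powr (1/2)) \<ge> \<eta> * g \<omega>" if "\<omega> \<ge> max w 1" for \<omega>
  proof -
    have "g \<omega> > 0" using assms that by (auto simp: admissible_nonlinearity_def)
    then show ?thesis using w[of \<omega>] that by (simp add: field_simps)
  qed
  then show thesis using \<eta>(1) by (intro that[of \<eta> "max w 1"]) auto
qed

text \<open>
  If the average \<open>P r\<close> is at least \<open>\<omega>\<close>, then two steps of length \<open>d\<close>, one for
  each inequality, raise it to \<open>2 * \<omega>\<close>. The first summand of \<open>d\<close> is the length that
  makes \<open>d powr s * X \<omega>\<close> comparable with \<open>\<omega>\<close>. The second summand makes \<open>Q\<close>
  exceed the square root of \<open>\<omega>\<close> after the first step, so that \<open>g1\<close> at the value of
  \<open>Q\<close> is comparable with \<open>g1 \<omega>\<close>.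
\<close>

lemma doubling_step:
  fixes P Q g1 g2 :: "real \<Rightarrow> real" and lam1 lam2 C :: real and m1 m2 :: nat
  defines "s \<equiv> real m1 + lam1 * real m2"
  defines "X \<equiv> \<lambda>\<zeta>. \<zeta> powr (lam1 * lam2) * g1 \<zeta> * g2 \<zeta> powr lam1"
  assumes adm1: "admissible_nonlinearity f1 lam1 mu1 g1 h1"
    and adm2: "admissible_nonlinearity f2 lam2 mu2 g2 h2"
    and m: "m1 \<ge> 1" "m2 \<ge> 1" and C: "C > 0"
    and I1: "\<And>r R. 0 < r \<Longrightarrow> r < R \<Longrightarrow> R \<le> 2 * r \<Longrightarrow> (R - r) ^ m1 * f1 (Q r) \<le> C * P R"
    and I2: "\<And>r R. 0 < r \<Longrightarrow> r < R \<Longrightarrow> R \<le> 2 * r \<Longrightarrow> (R - r) ^ m2 * f2 (P r) \<le> C * Q R"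
  obtains K w where "K \<ge> 1" "w \<ge> 1"
    "\<And>r \<omega> d. \<omega> \<ge> w \<Longrightarrow> d = K * (X \<omega> powr (- 1 / s) * \<omega> powr (1 / s) + \<omega> powr (- 1 / (2 * real m2))) \<Longrightarrow>
      2 * d \<le> r \<Longrightarrow> P r \<ge> \<omega> \<Longrightarrow> P (r + 2 * d) \<ge> 2 * \<omega>"
proof -
  obtain \<eta> w where \<eta>: "\<eta> > 0" "w \<ge> 1" "\<And>\<omega>. \<omega> \<ge> w \<Longrightarrow> g1 (\<omega> powr (1/2)) \<ge> \<eta> * g1 \<omega>"
    using admissible_sqrt[OF adm1] by blast
  note lam = admissibleD(1)[OF adm1] admissibleD(1)[OF adm2]
  note g_pos = admissibleD(2)[OF adm1] admissibleD(2)[OF adm2]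
  note g_mono = admissibleD(3)[OF adm1] admissibleD(3)[OF adm2]
  note f_mono = admissibleD(4)[OF adm1] admissibleD(4)[OF adm2]
  note f_ge = admissibleD(5)[OF adm1] admissibleD(5)[OF adm2]
  have s: "s \<ge> 1"
    unfolding s_def using m lam by (smt (verit) mult_nonneg_nonneg of_nat_0_le_iff of_nat_1 of_nat_mono)
  \<comment> \<open>The second entry gives the lower bound for \<open>q\<close>, the third one the factor 2 in the conclusion.\<close>
  define K where "K = max 1 (max (C / g2 1) (2 * C powr (lam1 + 1) / \<eta>))"
  have K: "K \<ge> 1" "K \<ge> C / g2 1" "K \<ge> 2 * C powr (lam1 + 1) / \<eta>" by (auto simp: K_def)
  have "P (r + 2 * d) \<ge> 2 * \<omega>"
    if \<omega>: "\<omega> \<ge> w" and d_eq: "d = K * (X \<omega> powr (- 1 / s) * \<omega> powr (1 / s) + \<omega> powr (- 1 / (2 * real m2)))"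
      and r: "2 * d \<le> r" "P r \<ge> \<omega>" for r \<omega> d
  proof -
    have \<omega>1: "\<omega> \<ge> 1" using \<omega> \<eta>(2) by simp
    have X: "X \<omega> > 0" using \<omega>1 g_pos[OF \<omega>1] by (simp add: X_def)
    define Y where "Y = X \<omega> powr (- 1 / s) * \<omega> powr (1 / s)"
    have Y: "Y > 0" using X \<omega>1 by (simp add: Y_def)
    have d1: "d \<ge> K * Y" and d2: "d \<ge> K * \<omega> powr (- 1 / (2 * real m2))" and d: "d > 0"
      using K(1) Y \<omega>1 unfolding d_eq Y_def[symmetric]
      by (auto simp: distrib_left add_pos_nonneg)
    \<comment> \<open>A lower bound for \<open>Q\<close> after the first of the two steps.\<close>
    define q where "q = d ^ m2 * (\<omega> powr lam2 * g2 \<omega>) / C"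
    have "d ^ m2 * (\<omega> powr lam2 * g2 \<omega>) \<le> d ^ m2 * f2 (P r)"
      using d f_ge(2)[OF \<omega>1] f_mono(2)[of \<omega> "P r"] r(2) \<omega>1 by (intro mult_left_mono) auto
    also have "\<dots> \<le> C * Q (r + d)"
      using I2[of r "r + d"] r d by simp
    finally have Qq: "Q (r + d) \<ge> q"
      using C by (simp add: q_def field_simps)
    have q: "q \<ge> \<omega> powr (1/2)"
    proof -
      have "(\<omega> powr (- 1 / (2 * real m2))) ^ m2 = \<omega> powr (- 1 / 2)"
        using m \<omega>1 by (simp add: powr_power field_simps)
      moreover have "K \<le> K ^ m2" using K(1) m(2) by (simp add: self_le_power)
      moreover have "(K * \<omega> powr (- 1 / (2 * real m2))) ^ m2 \<le> d ^ m2"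
        using d2 K(1) by (intro power_mono) auto
      ultimately have 1: "K * \<omega> powr (- 1 / 2) \<le> d ^ m2"
        using mult_right_mono[of K "K ^ m2" "\<omega> powr (- 1 / 2)"] by (simp add: power_mult_distrib)
      have 2: "\<omega> powr 1 * g2 1 \<le> \<omega> powr lam2 * g2 \<omega>"
        using \<omega>1 lam g_pos(2)[of 1] g_mono(2)[of 1 \<omega>] by (intro mult_mono powr_mono) auto
      have "\<omega> powr (1/2) * C = C * (\<omega> powr (- 1 / 2) * \<omega> powr 1)"
        by (subst powr_add[symmetric]) simp
      also have "\<dots> \<le> (K * g2 1) * (\<omega> powr (- 1 / 2) * \<omega> powr 1)"
        using K(2) g_pos(2)[of 1] by (intro mult_right_mono) (auto simp: field_simps)
      also have "\<dots> = (K * \<omega> powr (- 1 / 2)) * (\<omega> powr 1 * g2 1)"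
        by (simp add: mult_ac)
      also have "\<dots> \<le> d ^ m2 * (\<omega> powr lam2 * g2 \<omega>)"
        using d g_pos(2)[of 1] \<omega>1 by (intro mult_mono[OF 1 2]) auto
      finally show ?thesis using C by (simp add: q_def field_simps)
    qed
    have \<omega>h: "\<omega> powr (1/2) \<ge> 1" using \<omega>1 by (simp add: ge_one_powr_ge_zero)
    have "d powr s * X \<omega> * (\<eta> / C powr lam1) = d ^ m1 * (q powr lam1 * (\<eta> * g1 \<omega>))"
      using d C \<omega>1 g_pos(2)[OF \<omega>1]
      by (simp add: s_def X_def q_def powr_mult powr_divide powr_add powr_powr powr_realpow[symmetric] mult_ac)
    also have "\<dots> \<le> d ^ m1 * (q powr lam1 * g1 q)"
      using d \<eta>(3)[OF \<omega>] g_mono(1)[OF \<omega>h q] by (intro mult_left_mono) auto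
    also have "\<dots> \<le> d ^ m1 * f1 (Q (r + d))"
      using d f_ge(1)[of q] f_mono(1)[OF _ Qq] q \<omega>h by (intro mult_left_mono) auto
    also have "\<dots> \<le> C * P (r + 2 * d)"
      using I1[of "r + d" "r + 2 * d"] r d by simp
    finally have 1: "d powr s * X \<omega> * (\<eta> / C powr lam1) \<le> C * P (r + 2 * d)" .
    have "Y powr s = X \<omega> powr (- 1) * \<omega> powr 1"
      unfolding Y_def using X \<omega>1 s by (subst powr_mult) (auto simp only: powr_powr, simp_all)
    then have "Y powr s * X \<omega> = \<omega>"
      using X \<omega>1 by (simp add: powr_neg_one)
    then have "K * \<omega> = K * (Y powr s * X \<omega>)" by simp
    also have "\<dots> \<le> K powr s * (Y powr s * X \<omega>)"
      using powr_mono[of 1 s K] K(1) s X by (intro mult_right_mono) auto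
    also have "\<dots> = (K * Y) powr s * X \<omega>"
      using K(1) Y by (simp add: powr_mult)
    also have "\<dots> \<le> d powr s * X \<omega>"
      using d1 K(1) Y X s by (intro mult_right_mono powr_mono2) auto
    finally have 2: "K * \<omega> \<le> d powr s * X \<omega>" .
    have "2 * C powr (lam1 + 1) / \<eta> * \<omega> \<le> K * \<omega>"
      using K(3) \<omega>1 by (intro mult_right_mono) auto
    then have "2 * C powr (lam1 + 1) / \<eta> * \<omega> \<le> d powr s * X \<omega>"
      using 2 by simp
    then have "2 * C powr (lam1 + 1) / \<eta> * \<omega> * (\<eta> / C powr lam1) \<le> d powr s * X \<omega> * (\<eta> / C powr lam1)"
      using \<eta>(1) by (intro mult_right_mono) auto
    also have "2 * C powr (lam1 + 1) / \<eta> * \<omega> * (\<eta> / C powr lam1) = C * (2 * \<omega>)"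
      using \<eta>(1) C by (simp add: powr_add)
    finally have "C * (2 * \<omega>) \<le> C * P (r + 2 * d)" using 1 by simp
    then show ?thesis using C by simp
  qed
  then show thesis using K(1) \<eta>(2) that by blast
qed

text \<open>
  A positive lower bound for \<open>P\<close> gives linear growth of \<open>Q\<close> through the second inequality, and
  this gives linear growth of \<open>P\<close> through the first, as \<open>f1\<close> grows at least linearly.
\<close>

lemma linear_growth:
  fixes P Q :: "real \<Rightarrow> real"
  assumes adm1: "admissible_nonlinearity f1 lam1 mu1 g1 h1"
    and adm2: "admissible_nonlinearity f2 lam2 mu2 g2 h2"
    and m: "m2 \<ge> 1" and C: "C > 0" and c: "c > 0" "\<And>r. r \<ge> \<rho> \<Longrightarrow> P r \<ge> c"
    and I1: "\<And>r R. 0 < r \<Longrightarrow> r < R \<Longrightarrow> R \<le> 2 * r \<Longrightarrow> (R - r) ^ m1 * f1 (Q r) \<le> C * P R"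
    and I2: "\<And>r R. 0 < r \<Longrightarrow> r < R \<Longrightarrow> R \<le> 2 * r \<Longrightarrow> (R - r) ^ m2 * f2 (P r) \<le> C * Q R"
  obtains e r1 where "e > 0" "\<And>r. r \<ge> r1 \<Longrightarrow> P r \<ge> e * r"
proof -
  define e where "e = f2 c / (2 * C)"
  have e: "e > 0" using admissible_pos[OF adm2 c(1)] C by (simp add: e_def)
  have Q: "Q s \<ge> e * s" if "s \<ge> 2 * max \<rho> 1" for s
  proof -
    have "s / 2 * f2 c \<le> (s / 2) ^ m2 * f2 (P (s / 2))"
    proof (rule mult_mono)
      show "s / 2 \<le> (s / 2) ^ m2" using that m by (intro self_le_power) auto
      have "\<rho> \<le> s / 2" using that by simp
      then show "f2 c \<le> f2 (P (s / 2))"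
        using adm2 c(1) c(2)[of "s / 2"]
        by (intro mono_onD[of "{0..}" f2]) (auto simp: admissible_nonlinearity_def)
      show "0 \<le> f2 c" using admissible_pos[OF adm2 c(1)] by simp
    qed (use that in auto)
    also have "\<dots> \<le> C * Q s" using I2[of "s / 2" s] that by simp
    finally show ?thesis using C by (simp add: e_def field_simps)
  qed
  have g: "g1 1 > 0" using adm1 by (simp add: admissible_nonlinearity_def)
  have "P r \<ge> (e * g1 1 / (2 * C)) * r" if r: "r \<ge> 2 * max (2 * max \<rho> 1) (1 / e)" for r
  proof -
    define s where "s = r / 2"
    have s: "s \<ge> 2 * max \<rho> 1" "s \<ge> 1 / e" "s \<ge> 1" using r by (auto simp: s_def)
    have "e * s \<ge> 1" using s(2) e by (simp add: field_simps)
    then have "Q s \<ge> 1" using Q[OF s(1)] by simp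
    then have "(e * s) * g1 1 \<le> f1 (Q s)"
      using admissible_ge_linear[OF adm1, of "Q s"] Q[OF s(1)] g by (smt (verit) mult_right_mono)
    also have "\<dots> \<le> s ^ m1 * f1 (Q s)"
      using s(3) admissible_pos[OF adm1, of "Q s"] \<open>Q s \<ge> 1\<close> by (simp add: mult_le_cancel_right1)
    also have "\<dots> \<le> C * P r" using I1[of s r] s(3) by (simp add: s_def)
    finally show ?thesis using C by (simp add: s_def field_simps)
  qed
  moreover have "e * g1 1 / (2 * C) > 0" using e g C by simp
  ultimately show thesis using that by blast
qed

text \<open>
  Starting from a radius at which \<open>P\<close> is large, the steps that double \<open>P\<close> have a finite total
  length, so \<open>P\<close> is arbitrarily large at radii below a fixed \<open>R\<close>. The monotonicity of
  \<open>r ^ n * P r\<close>, an integral over the cube up to a constant, excludes this.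
\<close>

lemma averages_blow_up:
  fixes P Q :: "real \<Rightarrow> real" and lam1 lam2 C :: real and m1 m2 n :: nat
  assumes adm1: "admissible_nonlinearity f1 lam1 mu1 g1 h1"
    and adm2: "admissible_nonlinearity f2 lam2 mu2 g2 h2"
    and m: "m1 \<ge> 1" "m2 \<ge> 1" and C: "C > 0" and c: "c > 0" "\<And>r. r \<ge> \<rho> \<Longrightarrow> P r \<ge> c"
    and I1: "\<And>r R. 0 < r \<Longrightarrow> r < R \<Longrightarrow> R \<le> 2 * r \<Longrightarrow> (R - r) ^ m1 * f1 (Q r) \<le> C * P R"
    and I2: "\<And>r R. 0 < r \<Longrightarrow> r < R \<Longrightarrow> R \<le> 2 * r \<Longrightarrow> (R - r) ^ m2 * f2 (P r) \<le> C * Q R"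
    and mono: "\<And>r R. 0 < r \<Longrightarrow> r \<le> R \<Longrightarrow> r ^ n * P r \<le> R ^ n * P R"
    and fin: "(\<integral>\<^sup>+\<zeta>\<in>{1..}. ennreal
            ((\<zeta> powr (lam1 * lam2) * g1 \<zeta> * g2 \<zeta> powr lam1) powr (- 1 / (real m1 + lam1 * real m2))
              * \<zeta> powr (1 / (real m1 + lam1 * real m2) - 1)) \<partial>lborel) < \<infinity>"
  shows False
proof -
  define s where "s = real m1 + lam1 * real m2"
  define X where "X = (\<lambda>\<zeta>. \<zeta> powr (lam1 * lam2) * g1 \<zeta> * g2 \<zeta> powr lam1)"
  define W where "W = (\<lambda>\<zeta>. X \<zeta> powr (- 1 / s) * \<zeta> powr (1 / s - 1))"
  note lam = admissibleD(1)[OF adm1] admissibleD(1)[OF adm2]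
  note g_pos = admissibleD(2)[OF adm1] admissibleD(2)[OF adm2]
  note g_mono = admissibleD(3)[OF adm1] admissibleD(3)[OF adm2]
  have s: "s \<ge> 1"
    unfolding s_def using m lam by (smt (verit) mult_nonneg_nonneg of_nat_0_le_iff of_nat_1 of_nat_mono)
  obtain K w where Kw: "K \<ge> 1" "w \<ge> 1" and
    step: "\<And>r \<omega> d. \<omega> \<ge> w \<Longrightarrow> d = K * (X \<omega> powr (- 1 / s) * \<omega> powr (1 / s) + \<omega> powr (- 1 / (2 * real m2))) \<Longrightarrow>
      2 * d \<le> r \<Longrightarrow> P r \<ge> \<omega> \<Longrightarrow> P (r + 2 * d) \<ge> 2 * \<omega>"
    using doubling_step[OF adm1 adm2 m C I1 I2] unfolding s_def X_def by blast
  define \<omega>0 where "\<omega>0 = max w 2"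
  have \<omega>0: "\<omega>0 \<ge> 2" "\<omega>0 \<ge> w" by (auto simp: \<omega>0_def)
  define \<omega> where "\<omega> = (\<lambda>k::nat. 2 ^ k * \<omega>0)"
  have \<omega>: "\<omega> k \<ge> \<omega>0" for k
    using mult_right_mono[of 1 "2 ^ k" \<omega>0] \<omega>0 by (simp add: \<omega>_def)
  define d where "d = (\<lambda>k. K * (X (\<omega> k) powr (- 1 / s) * \<omega> k powr (1 / s) + \<omega> k powr (- 1 / (2 * real m2))))"
  have d_nonneg: "d k \<ge> 0" for k
    using Kw by (simp add: d_def)
  have "summable (\<lambda>k. \<omega> k * W (\<omega> k))"
    unfolding \<omega>_def
  proof (rule summable_dyadic_if_nn_integral_finite[OF _ _ _ \<omega>0(1)])
    show "W x \<ge> 0" for x by (simp add: W_def)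
    show "(\<integral>\<^sup>+\<zeta>\<in>{1..}. ennreal (W \<zeta>) \<partial>lborel) < \<infinity>"
      using fin by (simp add: W_def X_def s_def)
    show "W y \<le> W x" if xy: "1 \<le> x" "x \<le> y" for x y
    proof -
      have "X x \<le> X y"
        unfolding X_def using xy lam g_pos[of x] g_mono[OF xy] by (intro mult_mono powr_mono2) auto
      moreover have "X x > 0" using xy g_pos[of x] by (simp add: X_def)
      ultimately show ?thesis
        unfolding W_def using xy s by (intro mult_mono powr_mono2') auto
    qed
  qed
  also have "(\<lambda>k. \<omega> k * W (\<omega> k)) = (\<lambda>k. X (\<omega> k) powr (- 1 / s) * \<omega> k powr (1 / s))"
  proof
    fix k
    show "\<omega> k * W (\<omega> k) = X (\<omega> k) powr (- 1 / s) * \<omega> k powr (1 / s)"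
      using \<omega>[of k] \<omega>0 by (simp add: W_def powr_diff)
  qed
  finally have sum1: "summable (\<lambda>k. X (\<omega> k) powr (- 1 / s) * \<omega> k powr (1 / s))" .
  have "2 powr (- 1 / (2 * real m2)) < (1::real)"
    using m by (intro powr_less_one) auto
  then have "summable (\<lambda>k. (2 powr (- 1 / (2 * real m2))) ^ k * \<omega>0 powr (- 1 / (2 * real m2)))"
    by (intro summable_mult2 summable_geometric) simp
  also have "(\<lambda>k. (2 powr (- 1 / (2 * real m2))) ^ k * \<omega>0 powr (- 1 / (2 * real m2))) =
      (\<lambda>k. \<omega> k powr (- 1 / (2 * real m2)))"
    using \<omega>0 by (auto simp: \<omega>_def powr_mult powr_power powr_realpow[symmetric] powr_powr mult.commute)
  finally have "summable d"
    unfolding d_def by (intro summable_mult summable_add sum1)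
  define D where "D = suminf d"
  have sum_d: "(\<Sum>j<k. d j) \<le> D" for k
    unfolding D_def using \<open>summable d\<close> d_nonneg by (intro sum_le_suminf) auto
  have d_D: "d k \<le> D" for k
    using sum_d[of "Suc k"] sum_nonneg[of "{..<k}" d] d_nonneg by simp
  have D0: "D \<ge> 0" using d_D[of 0] d_nonneg[of 0] by simp
  obtain e r1 where e: "e > 0" "\<And>r. r \<ge> r1 \<Longrightarrow> P r \<ge> e * r"
    using linear_growth[OF adm1 adm2 m(2) C c I1 I2] by blast
  \<comment> \<open>From this radius on, \<open>P\<close> is at least \<open>\<omega>0\<close>, and no pair of steps is longer than the radius it starts from.\<close>
  define r0 where "r0 = max (max r1 (\<omega>0 / e)) (2 * D + 1)"
  have r0: "r0 \<ge> r1" "r0 \<ge> \<omega>0 / e" "r0 \<ge> 2 * D" "r0 > 0" using D0 by (auto simp: r0_def)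
  define r where "r = (\<lambda>k. r0 + 2 * (\<Sum>j<k. d j))"
  have r_ge: "r k \<ge> r0" for k using d_nonneg by (simp add: r_def sum_nonneg)
  have P_r: "P (r k) \<ge> \<omega> k" for k
  proof (induction k)
    case 0
    have "\<omega>0 \<le> e * r0" using r0(2) e(1) by (simp add: field_simps)
    also have "\<dots> \<le> P r0" by (rule e(2)[OF r0(1)])
    finally show ?case by (simp add: r_def \<omega>_def)
  next
    case (Suc k)
    have "P (r k + 2 * d k) \<ge> 2 * \<omega> k"
    proof (rule step[OF _ d_def[THEN fun_cong]])
      show "w \<le> \<omega> k" using \<omega>[of k] \<omega>0(2) by simp
      show "2 * d k \<le> r k" using d_D[of k] r0(3) r_ge[of k] by simp
    qed (rule Suc)
    then show ?case by (simp add: r_def \<omega>_def algebra_simps)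
  qed
  define R where "R = r0 + 2 * D"
  have "r0 ^ n * \<omega> k \<le> R ^ n * P R" for k
  proof -
    have "r0 ^ n * \<omega> k \<le> r k ^ n * P (r k)"
      using r_ge[of k] r0(4) P_r[of k] \<omega>[of k] \<omega>0 by (intro mult_mono power_mono) auto
    also have "\<dots> \<le> R ^ n * P R"
      using r_ge[of k] r0(4) sum_d[of k] by (intro mono) (auto simp: R_def r_def)
    finally show ?thesis .
  qed
  then have bound: "2 ^ k \<le> R ^ n * P R / (r0 ^ n * \<omega>0)" for k
    using r0(4) \<omega>0 by (simp add: \<omega>_def field_simps)
  obtain k where "R ^ n * P R / (r0 ^ n * \<omega>0) < 2 ^ k"
    using real_arch_pow[of 2] by auto
  with bound[of k] show False by simp
qed

section \<open>Triviality of solutions\<close>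

text \<open>
  The integral estimate combined with Jensen's inequality; doubling the radius changes the volume only
  by the factor \<open>2 ^ CARD('n)\<close>.
\<close>

lemma average_estimate:
  fixes u v :: "real ^ 'n::finite \<Rightarrow> real"
  assumes f: "convex_on {0..} f" "mono_on {0..} f" and r: "0 < r" "r < R" "R \<le> 2 * r"
    and v: "locally_integrable v" "locally_integrable (\<lambda>x. f \<bar>v x\<bar>)"
    and C: "C \<ge> 0" and est: "(R - r) ^ m * (LINT x:cube r|lebesgue. f \<bar>v x\<bar>) \<le> C * (LINT x:cube R|lebesgue. \<bar>u x\<bar>)"
  shows "(R - r) ^ m * f ((LINT x:cube r|lebesgue. \<bar>v x\<bar>) / (2 * r) ^ CARD('n))
    \<le> (C * 2 ^ CARD('n)) * ((LINT x:cube R|lebesgue. \<bar>u x\<bar>) / (2 * R) ^ CARD('n))"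
proof -
  let ?n = "CARD('n)"
  define p where "p = (LINT x:cube R|lebesgue. \<bar>u x\<bar>) / (2 * R) ^ ?n"
  define q where "q = (LINT x:cube r|lebesgue. \<bar>v x\<bar>) / (2 * r) ^ ?n"
  have "p \<ge> 0"
    unfolding p_def set_lebesgue_integral_def
    using r by (intro divide_nonneg_nonneg Bochner_Integration.integral_nonneg) auto
  have "(R - r) ^ m * ((2 * r) ^ ?n * f q) \<le> (R - r) ^ m * (LINT x:cube r|lebesgue. f \<bar>v x\<bar>)"
    unfolding q_def using r by (intro mult_left_mono Jensen_cube f v) auto
  also have "\<dots> \<le> C * (LINT x:cube R|lebesgue. \<bar>u x\<bar>)" by (rule est)
  also have "\<dots> = C * ((2 * R) ^ ?n * p)" using r by (simp add: p_def)
  also have "\<dots> \<le> C * ((2 * (2 * r)) ^ ?n * p)"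
    using C r \<open>p \<ge> 0\<close> by (intro mult_left_mono mult_right_mono power_mono) auto
  also have "\<dots> = (2 * r) ^ ?n * (C * 2 ^ ?n * p)"
    by (subst power_mult_distrib) (simp only: mult_ac)
  finally have "(2 * r) ^ ?n * ((R - r) ^ m * f q) \<le> (2 * r) ^ ?n * (C * 2 ^ ?n * p)"
    by (simp add: mult_ac)
  moreover have "(2 * r) ^ ?n > 0" using r by simp
  ultimately have "(R - r) ^ m * f q \<le> C * 2 ^ ?n * p"
    by (simp only: mult_le_cancel_left_pos)
  then show ?thesis by (simp only: p_def q_def)
qed

theorem theorem2p2:
  fixes m1 m2 :: nat
    and a b :: "('n::finite \<Rightarrow> nat) \<Rightarrow> real ^ 'n \<Rightarrow> real \<Rightarrow> real"
    and A lam1 lam2 mu1 mu2 :: real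
    and f1 f2 g1 g2 h1 h2 :: "real \<Rightarrow> real"
    and u1 u2 :: "real ^ 'n \<Rightarrow> real"
  assumes "m1 \<ge> 1" and "m2 \<ge> 1"
    and "\<And>\<alpha>. \<alpha> \<in> multi_indices m1 \<Longrightarrow> caratheodory (a \<alpha>)"
    and "\<And>\<beta>. \<beta> \<in> multi_indices m2 \<Longrightarrow> caratheodory (b \<beta>)"
    and "A > 0"
    and "\<And>\<alpha> \<beta>. \<alpha> \<in> multi_indices m1 \<Longrightarrow> \<beta> \<in> multi_indices m2 \<Longrightarrow>
           AE x in lebesgue. \<forall>\<zeta>. \<bar>a \<alpha> x \<zeta>\<bar> + \<bar>b \<beta> x \<zeta>\<bar> \<le> A * \<bar>\<zeta>\<bar>"
    and "admissible_nonlinearity f1 lam1 mu1 g1 h1"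
    and "admissible_nonlinearity f2 lam2 mu2 g2 h2"
    and "m1 \<ge> CARD('n)"
    and "(\<integral>\<^sup>+\<zeta>\<in>{1..}. ennreal
            ((\<zeta> powr (lam1 * lam2) * g1 \<zeta> * g2 \<zeta> powr lam1) powr (- 1 / (real m1 + lam1 * real m2))
              * \<zeta> powr (1 / (real m1 + lam1 * real m2) - 1)) \<partial>lborel) < \<infinity>"
    and "weak_solution m1 m2 a b f1 f2 u1 u2"
  shows "(AE x in lebesgue. u1 x = 0) \<and> (AE x in lebesgue. u2 x = 0)"
proof -
  note m = assms(1,2) and A = assms(5) and adm1 = assms(7) and adm2 = assms(8)
    and n = assms(9) and fin = assms(10) and sol = assms(11)
  let ?n = "CARD('n)"
  have f1: "convex_on {0..} f1" "mono_on {0..} f1" "\<And>\<zeta>. \<zeta> \<ge> 0 \<Longrightarrow> f1 \<zeta> \<ge> 0"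
    using adm1 by (simp_all add: admissible_nonlinearity_def)
  have f2: "convex_on {0..} f2" "mono_on {0..} f2" "\<And>\<zeta>. \<zeta> \<ge> 0 \<Longrightarrow> f2 \<zeta> \<ge> 0"
    using adm2 by (simp_all add: admissible_nonlinearity_def)
  have u: "locally_integrable u1" "locally_integrable u2"
    "locally_integrable (\<lambda>x. f1 \<bar>u2 x\<bar>)" "locally_integrable (\<lambda>x. f2 \<bar>u1 x\<bar>)"
    using sol by (simp_all add: weak_solution_def)
  have growth_a: "AE x in lebesgue. \<forall>\<zeta>. \<bar>a \<alpha> x \<zeta>\<bar> \<le> A * \<bar>\<zeta>\<bar>" if \<alpha>: "\<alpha> \<in> multi_indices m1" for \<alpha>
  proof -
    obtain \<beta> :: "'n \<Rightarrow> nat" where "\<beta> \<in> multi_indices m2" using multi_indices_nonempty by blast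
    from assms(6)[OF \<alpha> this] show ?thesis
      by eventually_elim (meson abs_ge_zero add_increasing2 order.refl order.trans)
  qed
  have growth_b: "AE x in lebesgue. \<forall>\<zeta>. \<bar>b \<beta> x \<zeta>\<bar> \<le> A * \<bar>\<zeta>\<bar>" if \<beta>: "\<beta> \<in> multi_indices m2" for \<beta>
  proof -
    obtain \<alpha> :: "'n \<Rightarrow> nat" where "\<alpha> \<in> multi_indices m1" using multi_indices_nonempty by blast
    from assms(6)[OF this \<beta>] show ?thesis
      by eventually_elim (meson abs_ge_zero add_increasing order.refl order.trans)
  qed
  obtain C1 where C1: "C1 \<ge> 0" and est1: "\<And>r R. 0 < r \<Longrightarrow> r < R \<Longrightarrow>
      (R - r) ^ m1 * (LINT x:cube r|lebesgue. f1 \<bar>u2 x\<bar>) \<le> C1 * (LINT x:cube R|lebesgue. \<bar>u1 x\<bar>)"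
  proof (rule cube_integral_estimate[of A m1 a u1 "\<lambda>x. f1 \<bar>u2 x\<bar>"])
    show "(\<integral>x. f1 \<bar>u2 x\<bar> * \<phi> x \<partial>lebesgue) \<le>
      (-1) ^ m1 * (\<integral>x. (\<Sum>\<alpha>\<in>multi_indices m1. a \<alpha> x (u1 x) * multi_partial \<alpha> \<phi> x) \<partial>lebesgue)"
      if "test_function \<phi>" "\<And>x. \<phi> x \<ge> 0" for \<phi>
      using sol that unfolding weak_solution_def by blast
  qed (use A growth_a u f1 in auto)
  obtain C2 where C2: "C2 \<ge> 0" and est2: "\<And>r R. 0 < r \<Longrightarrow> r < R \<Longrightarrow>
      (R - r) ^ m2 * (LINT x:cube r|lebesgue. f2 \<bar>u1 x\<bar>) \<le> C2 * (LINT x:cube R|lebesgue. \<bar>u2 x\<bar>)"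
  proof (rule cube_integral_estimate[of A m2 b u2 "\<lambda>x. f2 \<bar>u1 x\<bar>"])
    show "(\<integral>x. f2 \<bar>u1 x\<bar> * \<phi> x \<partial>lebesgue) \<le>
      (-1) ^ m2 * (\<integral>x. (\<Sum>\<beta>\<in>multi_indices m2. b \<beta> x (u2 x) * multi_partial \<beta> \<phi> x) \<partial>lebesgue)"
      if "test_function \<phi>" "\<And>x. \<phi> x \<ge> 0" for \<phi>
      using sol that unfolding weak_solution_def by blast
  qed (use A growth_b u f2 in auto)
  have no_mass: "(LINT x:cube r|lebesgue. f1 \<bar>u2 x\<bar>) \<le> 0" if r: "r > 0" for r
  proof (rule ccontr)
    define \<delta> where "\<delta> = (LINT x:cube r|lebesgue. f1 \<bar>u2 x\<bar>)"
    assume "\<not> (LINT x:cube r|lebesgue. f1 \<bar>u2 x\<bar>) \<le> 0"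
    then have \<delta>: "\<delta> > 0" by (simp add: \<delta>_def)
    define P where "P = (\<lambda>r. (LINT x:cube r|lebesgue. \<bar>u1 x\<bar>) / (2 * r) ^ ?n)"
    define Q where "Q = (\<lambda>r. (LINT x:cube r|lebesgue. \<bar>u2 x\<bar>) / (2 * r) ^ ?n)"
    have nonneg: "P r \<ge> 0" "Q r \<ge> 0" if "r > 0" for r
      unfolding P_def Q_def set_lebesgue_integral_def
      using that by (auto intro!: divide_nonneg_nonneg Bochner_Integration.integral_nonneg)
    define C where "C = (C1 + C2 + 1) * 2 ^ ?n"
    have "C > 0" using C1 C2 by (simp add: C_def)
    have C: "C1 * 2 ^ ?n \<le> C" "C2 * 2 ^ ?n \<le> C"
      using C1 C2 unfolding C_def by (auto intro: mult_right_mono)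
    define c where "c = \<delta> / ((C1 + 1) * 4 ^ ?n)"
    have "c > 0" using \<delta> C1 by (simp add: c_def)
    show False
    proof (rule averages_blow_up[OF adm1 adm2 m \<open>C > 0\<close> \<open>c > 0\<close> _ _ _ _ fin])
      show "c \<le> P t" if t: "t \<ge> 2 * max r 1" for t
      proof -
        define s where "s = t / 2"
        have s: "s \<ge> r" "s \<ge> 1" using t by (auto simp: s_def)
        \<comment> \<open>The hypothesis that \<open>m1\<close> is at least the dimension enters here only.\<close>
        have "s ^ ?n * \<delta> \<le> s ^ m1 * (LINT x:cube s|lebesgue. f1 \<bar>u2 x\<bar>)"
          using s n \<delta> f1(3) unfolding \<delta>_def
          by (intro mult_mono power_increasing set_integral_cube_mono u) auto
        also have "\<dots> \<le> C1 * (LINT x:cube t|lebesgue. \<bar>u1 x\<bar>)"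
          using est1[of s t] s by (simp add: s_def)
        also have "\<dots> = C1 * ((4 * s) ^ ?n * P t)"
          using s by (simp add: P_def s_def)
        also have "\<dots> \<le> (C1 + 1) * ((4 * s) ^ ?n * P t)"
          using s nonneg(1)[of t] by (intro mult_right_mono mult_nonneg_nonneg) (auto simp: s_def)
        finally have "s ^ ?n * \<delta> \<le> s ^ ?n * ((C1 + 1) * 4 ^ ?n * P t)"
          by (simp add: power_mult_distrib mult_ac)
        then have "\<delta> \<le> (C1 + 1) * 4 ^ ?n * P t"
          using s by simp
        moreover have "(C1 + 1) * 4 ^ ?n > 0" using C1 by simp
        ultimately show ?thesis by (simp only: c_def pos_divide_le_eq mult_ac)
      qed
      show "(R - r) ^ m1 * f1 (Q r) \<le> C * P R" if "0 < r" "r < R" "R \<le> 2 * r" for r R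
        using average_estimate[OF f1(1,2) that u(2,3) C1 est1[OF that(1,2)]]
          mult_right_mono[OF C(1), of "P R"] nonneg(1)[of R] that
        by (simp add: P_def Q_def)
      show "(R - r) ^ m2 * f2 (P r) \<le> C * Q R" if "0 < r" "r < R" "R \<le> 2 * r" for r R
        using average_estimate[OF f2(1,2) that u(1,4) C2 est2[OF that(1,2)]]
          mult_right_mono[OF C(2), of "Q R"] nonneg(2)[of R] that
        by (simp add: P_def Q_def)
      show "r ^ ?n * P r \<le> R ^ ?n * P R" if "0 < r" "r \<le> R" for r R
        using set_integral_cube_mono[of "\<lambda>x. \<bar>u1 x\<bar>" r R] u(1) that
        by (simp add: P_def power_mult_distrib divide_right_mono locally_integrable_def set_integrable_abs)
    qed
  qed
  have "AE x in lebesgue. f1 \<bar>u2 x\<bar> = 0"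
    by (rule AE_zero_if_cube_integrals_zero[OF u(3) _ no_mass]) (use f1 in auto)
  then have u2: "AE x in lebesgue. u2 x = 0"
    by eventually_elim (use admissible_pos[OF adm1] in \<open>metis less_irrefl zero_less_abs_iff\<close>)
  have "(LINT x:cube r|lebesgue. f2 \<bar>u1 x\<bar>) \<le> 0" if r: "r > 0" for r
  proof -
    have "(LINT x:cube (2 * r)|lebesgue. \<bar>u2 x\<bar>) = 0"
      unfolding set_lebesgue_integral_def
      by (rule integral_eq_zero_AE) (use u2 in eventually_elim, simp)
    then have "r ^ m2 * (LINT x:cube r|lebesgue. f2 \<bar>u1 x\<bar>) \<le> 0"
      using est2[of r "2 * r"] r by simp
    then show ?thesis
      using zero_less_power[OF r, of m2] by (simp add: mult_le_0_iff del: zero_less_power zero_less_power_eq)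
  qed
  then have "AE x in lebesgue. f2 \<bar>u1 x\<bar> = 0"
    by (intro AE_zero_if_cube_integrals_zero u) (use f2 in auto)
  then have u1: "AE x in lebesgue. u1 x = 0"
    by eventually_elim (use admissible_pos[OF adm2] in \<open>metis less_irrefl zero_less_abs_iff\<close>)
  from u1 u2 show ?thesis by blast
qed

end
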